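(* Let $X$ be the random field on the torus described in the context and suppose that Assumption A2 (stated in the context) holds. Then the wavelet coefficients $\beta_{Nk}$ satisfy $$\big|\mathrm{Corr}(\beta_{Nk_1},\beta_{Nk_2})\big|\le\frac{2c_M}{(1+[k_1-k_2]_{N/2})^M}$$ for some $c_M>0$ (which does not depend on $N$), where $[a]_b$ means $a \pmod b$.
   Context: **Field.** $X(\vartheta)=\sum_{l=-\infty}^{\infty}w_l e^{il\vartheta}$, $\vartheta\in[0,2\pi]$, is a real-valued stationary random field on the torus, where $w_0=0$, $Ew_l=0$, $E|w_l|^2=C_l$, $w_{-l}=\overline{w_l}$ (so $C_{-l}=C_l$), $E[w_lw_{l'}]=0$ unless $l'=-l$, and $\sum_{l}C_l<\infty$. **Assumption A1.** There exists a function $g:\mathbb N\to[c_1,c_2]$, with $0<c_1\le c_2<\infty$, such that $g\in W_1^M$ for some $M\ge0$ (functions with integrable weak derivative of order $M$) and $C_l=g(l)l^{-\alpha}$ for all $l\in\mathbb N$, where $\alpha>1$. **Assumption A2.** A1 holds and there exists a sequence of functions $h_N:[\frac12,2]\to[\frac{c_1}{c_2},\frac{c_2}{c_1}]$ such that $$h_N(\tfrac{4l}N):=\frac{g(l)}{g(\frac N4)},\qquad \tfrac N8\le l\le\tfrac N2,\quad N=8,16,32,\dots,$$ and $\sup_N\sup_{1/2\le u\le2}|h_N^{(M)}(u)|\le C$ for some $C>0$ and some $M\in\mathbb N$, where $h_N^{(M)}$ denotes the $M$-th order weak derivative of $h_N$. This $M$ is the exponent in the claim. **Wavelets.** Let $\phi$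 be a $C^\infty$ function supported in $|\xi|\le1$ with $0\le\phi\le1$ and $\phi(\xi)=1$ for $|\xi|\le\frac12$, and let $a$ be given by $a^2(\xi)=\phi(\xi/2)-\phi(\xi)\ge0$. The function $a$ is taken to be $C^\infty$ and even, and it vanishes unless $\frac12\le|\xi|\le2$. For $j\in\mathbb N$ put $N=2^{j+2}$, $\tau=2\pi/N$, and for $k\in\{0,\dots,N-1\}$ $$\psi_N(t)=\frac1{\sqrt N}\sum_{l=-\infty}^{\infty}a(\tfrac{4l}N)e^{ilt},\qquad \psi_{Nk}(t)=\psi_N(t-k\tau),\qquad \beta_{Nk}=\frac1{2\pi}\int_{-\pi}^{\pi}X(\vartheta)\psi_{Nk}(\vartheta)\,d\vartheta .$$ The correlation coefficient is $$\mathrm{Corr}(\beta_{Nk_1},\beta_{Nk_2})=\frac{\sum_{N/8\le|l|\le N/2}C_la^2(\frac{4l}N)e^{il\frac{2\pi}N(k_1-k_2)}}{\sum_{N/8\le|l|\le N/2}C_la^2(\frac{4l}N)}.$$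
   Formalization: [k1-k2]_{N/2} is read as the absolute value of the representative of k1-k2 modulo N in [-N/2,N/2), not the least nonnegative residue mod N/2: with that residue the bound fails for M≥1, since Corr is even and N-periodic but lag -1 has residue N/2-1. *)

theory Defs
  imports "HOL-Probability.Probability"
begin

definition smooth :: "(real \<Rightarrow> real) \<Rightarrow> bool" where
  "smooth f \<longleftrightarrow> (\<forall>n x. ((deriv ^^ n) f) field_differentiable at x)"

definition test_function :: "real set \<Rightarrow> (real \<Rightarrow> real) \<Rightarrow> bool" where
  "test_function U \<eta> \<longleftrightarrow>
     smooth \<eta> \<and> (\<exists>K. compact K \<and> K \<subseteq> U \<and> (\<forall>x. x \<notin> K \<longrightarrow> \<eta> x = 0))"

definition locally_integrable :: "real set \<Rightarrow> (real \<Rightarrow> real) \<Rightarrow> bool" where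
  "locally_integrable U f \<longleftrightarrow>
     (\<forall>K. compact K \<longrightarrow> K \<subseteq> U \<longrightarrow> set_integrable lebesgue K f)"

text \<open>\<open>v\<close> is (a version of) the weak derivative of order \<open>k\<close> of \<open>f\<close> on the interval \<open>I\<close>.
  Weak derivatives only see \<open>f\<close> up to null sets, whereas below \<open>f\<close> is evaluated at
  individual points; so for \<open>k > 0\<close> the continuous representative is required.
  Without that clause the values at finitely or countably many points would be unconstrained.\<close>

definition has_weak_deriv ::
    "nat \<Rightarrow> real set \<Rightarrow> (real \<Rightarrow> real) \<Rightarrow> (real \<Rightarrow> real) \<Rightarrow> bool" where
  "has_weak_deriv k I f v \<longleftrightarrow>
     locally_integrable (interior I) f \<and> locally_integrable (interior I) v \<and>
     (\<forall>\<eta>. test_function (interior I) \<eta> \<longrightarrow>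
        (LINT x:interior I|lebesgue. f x * (deriv ^^ k) \<eta> x) =
        (-1) ^ k * (LINT x:interior I|lebesgue. v x * \<eta> x)) \<and>
     (k > 0 \<longrightarrow> continuous_on I f)"

text \<open>A sequence on the positive integers belongs to \<open>W\<^sub>1\<^sup>k\<close> if it is the restriction of
  a function on \<open>[1,\<infinity>)\<close> whose weak derivative of order \<open>k\<close> is integrable. Lower order
  derivatives are not required to be integrable: \<open>g\<close> itself, being bounded below, would not be.\<close>

definition in_W1 :: "nat \<Rightarrow> (nat \<Rightarrow> real) \<Rightarrow> bool" where
  "in_W1 k g \<longleftrightarrow>
     (\<exists>G v. (\<forall>l\<ge>1. G (real l) = g l) \<and> has_weak_deriv k {1..} G v \<and>
            set_integrable lebesgue {1..} v)"

definition assumption_A1 ::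
    "(int \<Rightarrow> real) \<Rightarrow> (nat \<Rightarrow> real) \<Rightarrow> real \<Rightarrow> real \<Rightarrow> real \<Rightarrow> bool" where
  "assumption_A1 C g c1 c2 \<alpha> \<longleftrightarrow>
     0 < c1 \<and> c1 \<le> c2 \<and> \<alpha> > 1 \<and>
     (\<forall>l\<ge>1. g l \<in> {c1..c2}) \<and> (\<exists>k. in_W1 k g) \<and>
     (\<forall>l\<ge>1. C (int l) = g l * real l powr (- \<alpha>))"

text \<open>The relevant values \<open>N = 8, 16, 32, \<dots>\<close> are \<open>N = 2\<^sup>j\<^sup>+\<^sup>2\<close> with \<open>j \<ge> 1\<close>. A bound, at every
  point, on some version of the weak derivative is an essential supremum bound.\<close>

definition assumption_A2 ::
    "(int \<Rightarrow> real) \<Rightarrow> (nat \<Rightarrow> real) \<Rightarrow> real \<Rightarrow> real \<Rightarrow> real \<Rightarrow> nat \<Rightarrow> bool" where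
  "assumption_A2 C g c1 c2 \<alpha> M \<longleftrightarrow>
     assumption_A1 C g c1 c2 \<alpha> \<and>
     (\<exists>(h :: nat \<Rightarrow> real \<Rightarrow> real) B. B > 0 \<and>
        (\<forall>j\<ge>1. let N = 2 ^ (j + 2) in
           (\<forall>u\<in>{1/2..2}. h N u \<in> {c1 / c2..c2 / c1}) \<and>
           (\<forall>l\<in>{N div 8..N div 2}. h N (4 * real l / real N) = g l / g (N div 4)) \<and>
           (\<exists>v. has_weak_deriv M {1/2..2} (h N) v \<and> (\<forall>u\<in>{1/2..2}. \<bar>v u\<bar> \<le> B))))"

text \<open>Stationarity is meant in the wide sense, the weakest reading.\<close>

definition wide_sense_stationary :: "'a measure \<Rightarrow> (real \<Rightarrow> 'a \<Rightarrow> real) \<Rightarrow> bool" where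
  "wide_sense_stationary P X \<longleftrightarrow>
     (\<forall>s t r. (\<integral>\<omega>. X (t + r) \<omega> \<partial>P) = (\<integral>\<omega>. X t \<omega> \<partial>P) \<and>
              (\<integral>\<omega>. X (s + r) \<omega> * X (t + r) \<omega> \<partial>P) = (\<integral>\<omega>. X s \<omega> * X t \<omega> \<partial>P))"

text \<open>The field is a jointly measurable \<open>2\<pi>\<close>-periodic function of the angle. Its series
  expansion holds in mean square at every angle: the \<open>w l\<close> are pairwise orthogonal and \<open>C\<close> is
  summable, which gives mean square but in general not pointwise convergence.
  It is stated with the nonnegative integral, so that it entails square integrability.\<close>

locale torus_field = prob_space P for P :: "'a measure" +
  fixes X :: "real \<Rightarrow> 'a \<Rightarrow> real" and w :: "int \<Rightarrow> 'a \<Rightarrow> complex" and C :: "int \<Rightarrow> real"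
  assumes X_measurable: "case_prod X \<in> borel_measurable (borel \<Otimes>\<^sub>M P)"
    and X_periodic: "\<And>t \<omega>. \<omega> \<in> space P \<Longrightarrow> X (t + 2 * pi) \<omega> = X t \<omega>"
    and X_stationary: "wide_sense_stationary P X"
    and w_measurable: "\<And>l. w l \<in> borel_measurable P"
    and w_square_integrable: "\<And>l. integrable P (\<lambda>\<omega>. (cmod (w l \<omega>))\<^sup>2)"
    and w_zero: "AE \<omega> in P. w 0 \<omega> = 0"
    and w_mean: "\<And>l. (\<integral>\<omega>. w l \<omega> \<partial>P) = 0"
    and w_power: "\<And>l. (\<integral>\<omega>. (cmod (w l \<omega>))\<^sup>2 \<partial>P) = C l"
    and w_conj: "\<And>l. AE \<omega> in P. w (- l) \<omega> = cnj (w l \<omega>)"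
    and w_uncorrelated: "\<And>l l'. l' \<noteq> - l \<Longrightarrow> (\<integral>\<omega>. w l \<omega> * w l' \<omega> \<partial>P) = 0"
    and C_summable: "C summable_on UNIV"
    and X_series: "\<And>t. (\<lambda>n. \<integral>\<^sup>+\<omega>. ennreal ((cmod (complex_of_real (X t \<omega>) -
           (\<Sum>l\<in>{- int n..int n}. w l \<omega> * cis (of_int l * t))))\<^sup>2) \<partial>P) \<longlonglongrightarrow> 0"

definition wavelet_window :: "(real \<Rightarrow> real) \<Rightarrow> (real \<Rightarrow> real) \<Rightarrow> bool" where
  "wavelet_window \<phi> a \<longleftrightarrow>
     smooth \<phi> \<and> (\<forall>\<xi>. \<bar>\<xi>\<bar> > 1 \<longrightarrow> \<phi> \<xi> = 0) \<and> (\<forall>\<xi>. 0 \<le> \<phi> \<xi> \<and> \<phi> \<xi> \<le> 1) \<and>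
     (\<forall>\<xi>. \<bar>\<xi>\<bar> \<le> 1/2 \<longrightarrow> \<phi> \<xi> = 1) \<and>
     smooth a \<and> (\<forall>\<xi>. a (- \<xi>) = a \<xi>) \<and> (\<forall>\<xi>. (a \<xi>)\<^sup>2 = \<phi> (\<xi> / 2) - \<phi> \<xi>) \<and>
     (\<forall>\<xi>. \<not> (1/2 \<le> \<bar>\<xi>\<bar> \<and> \<bar>\<xi>\<bar> \<le> 2) \<longrightarrow> a \<xi> = 0)"

definition wavelet :: "(real \<Rightarrow> real) \<Rightarrow> nat \<Rightarrow> real \<Rightarrow> complex" where
  "wavelet a N t = complex_of_real (1 / sqrt (real N)) *
     (\<Sum>\<^sub>\<infinity>l::int. complex_of_real (a (4 * of_int l / real N)) * cis (of_int l * t))"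

definition wavelet_shift :: "(real \<Rightarrow> real) \<Rightarrow> nat \<Rightarrow> nat \<Rightarrow> real \<Rightarrow> complex" where
  "wavelet_shift a N k t = wavelet a N (t - real k * (2 * pi / real N))"

definition wavelet_coeff ::
    "(real \<Rightarrow> real) \<Rightarrow> (real \<Rightarrow> 'a \<Rightarrow> real) \<Rightarrow> nat \<Rightarrow> nat \<Rightarrow> 'a \<Rightarrow> complex" where
  "wavelet_coeff a X N k \<omega> = complex_of_real (1 / (2 * pi)) *
     (LINT t:{-pi..pi}|lborel. complex_of_real (X t \<omega>) * wavelet_shift a N k t)"

definition covariance :: "'a measure \<Rightarrow> ('a \<Rightarrow> complex) \<Rightarrow> ('a \<Rightarrow> complex) \<Rightarrow> complex" where
  "covariance P Y Z =
     (\<integral>\<omega>. (Y \<omega> - (\<integral>\<omega>'. Y \<omega>' \<partial>P)) * cnj (Z \<omega> - (\<integral>\<omega>'. Z \<omega>' \<partial>P)) \<partial>P)"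

definition correlation :: "'a measure \<Rightarrow> ('a \<Rightarrow> complex) \<Rightarrow> ('a \<Rightarrow> complex) \<Rightarrow> complex" where
  "correlation P Y Z =
     covariance P Y Z / complex_of_real (sqrt (Re (covariance P Y Y) * Re (covariance P Z Z)))"

text \<open>\<open>[a]\<^sub>b\<close> with \<open>b = N/2\<close> and \<open>a = k\<^sub>1 - k\<^sub>2\<close>: the difference of two locations on the discrete
  circle of \<open>N = 2b\<close> points is represented in the window \<open>[-b, b)\<close>, and \<open>[a]\<^sub>b\<close> is the absolute
  value of that representative, that is, the distance of \<open>a\<close> to \<open>N\<int>\<close>.
  The least nonnegative residue of \<open>a\<close> modulo \<open>N/2\<close> cannot be meant: the correlation is even
  and \<open>N\<close>-periodic in \<open>a\<close>, so lags \<open>1\<close> and \<open>N - 1\<close> have the same correlation, but the latter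
  has residue \<open>N/2 - 1\<close>. The lemmas compare \<open>[a]\<^sub>b\<close> with residues modulo \<open>b\<close>.\<close>

definition centred_residue :: "int \<Rightarrow> int \<Rightarrow> int" where
  "centred_residue b a = \<bar>(a + b) mod (2 * b) - b\<bar>"

lemma centred_residue_eq_abs:
  assumes "b > 0" "\<bar>a\<bar> \<le> b"
  shows "centred_residue b a = \<bar>a\<bar>"
proof (cases "a = b")
  case True
  then show ?thesis using assms by (simp add: centred_residue_def flip: mult_2)
next
  case False
  then have "(a + b) mod (2 * b) = a + b" using assms by (intro mod_pos_pos_trivial) auto
  then show ?thesis by (simp add: centred_residue_def)
qed

lemma centred_residue_periodic: "centred_residue b (a + 2 * b * m) = centred_residue b a"
proof -
  have "a + 2 * b * m + b = (a + b) + (2 * b) * m" by simp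
  then show ?thesis unfolding centred_residue_def by (simp only: mod_mult_self2)
qed

lemma mod_le_centred_residue:
  assumes "b > 0" "0 \<le> a" "2 * a \<le> 3 * b"
  shows "a mod b \<le> centred_residue b a"
proof (cases "a \<le> b")
  case True
  then show ?thesis
    using assms centred_residue_eq_abs[of b a] zmod_le_nonneg_dividend[of a b] by simp
next
  case False
  have "centred_residue b a = \<bar>a - 2 * b\<bar>"
    using centred_residue_periodic[of b "a - 2 * b" 1] centred_residue_eq_abs[of b "a - 2 * b"]
      assms False by simp
  moreover have "a mod b = a - b"
    using False assms mod_pos_pos_trivial[of "a - b" b] by (simp add: mod_diff_right_eq)
  ultimately show ?thesis using assms False by simp
qed

lemma least_abs_residue_le_centred_residue:
  assumes "b > 0"
  shows "min (a mod b) (b - a mod b) \<le> centred_residue b a"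
proof -
  define r where "r = (a + b) mod (2 * b)"
  have r: "0 \<le> r" "r < 2 * b" using assms by (auto simp: r_def)
  have "r mod b = a mod b" by (simp add: r_def mod_mod_cancel)
  moreover have "r mod b = (if r < b then r else r - b)"
    using r mod_pos_pos_trivial[of r b] mod_pos_pos_trivial[of "r - b" b] by auto
  ultimately show ?thesis
    using r unfolding centred_residue_def r_def[symmetric] by (auto split: if_splits)
qed

end

theory Submission
  imports Defs
begin

text \<open>After division by the variance, the covariance is the exponential sum with coefficients
  \<open>f l = h\<^sub>N(u) u\<^sup>-\<^sup>\<alpha> a(u)\<^sup>2\<close> at \<open>u = 4 l / N\<close>. Summing by parts \<open>M\<close> times gains the factor
  \<open>\<bar>1 - e\<^sup>i\<^sup>\<theta>\<bar>\<^sup>-\<^sup>M\<close>, at most a constant times \<open>(N / [k\<^sub>1 - k\<^sub>2])\<^sup>M\<close>, and it remains to see that the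
  \<open>M\<close>-th differences of \<open>f\<close> are \<open>O(N\<^sup>-\<^sup>M)\<close>. For \<open>h\<^sub>N\<close> itself this is the bound on its weak derivative;
  the differences of lower order needed in the Leibniz rule follow by interpolation with the bound
  on \<open>h\<^sub>N\<close>. Where the difference stencil leaves \<open>[1/2, 2]\<close>, \<open>h\<^sub>N\<close> is not controlled, but there
  \<open>a\<close> vanishes to order \<open>M\<close>. The variance is bounded below using \<open>a(u)\<^sup>2 + a(2u)\<^sup>2 = 1\<close> on
  \<open>[1/2, 1]\<close>. Small \<open>N\<close> are covered by the trivial bound \<open>1\<close> on correlations.\<close>

section \<open>Finite differences\<close>

text \<open>The overview passes over the probabilistic half. The series for \<open>X\<close>
  converges only in mean square at each angle, so the Fourier coefficients of a path cannot be read
  off termwise. Averaging the error over angle and probability space gives L1 convergence, from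
  which almost every path is integrable with Fourier coefficients \<open>2 * pi * w (- l)\<close>.
  As the window has compact support, each wavelet coefficient is then almost surely a finite
  combination of the \<open>w l\<close>. The analytic half is discrete, because A2 ties h_N to the
  spectrum only at grid points and gives no bounds on derivatives of orders between 0 and M. With N
  = 8 m the grid is u = l / (2 m) and the window lives on m < l < 4 m. The powers of N balance:
  about N summands, each O(N^-M) after M differences, times N^M from the phase, against a normalised
  variance of order N. The result is independent of N only if the difference bounds are, so their
  constants are obtained before m, h_N and its weak derivative are fixed.\<close>

text \<open>Polymorphic in the argument, so that one operator serves sequences on \<open>nat\<close>
  and functions on \<open>real\<close>; \<open>fdiff_pow_grid\<close> passes between the
  two.\<close>

definition fdiff :: "'a::plus \<Rightarrow> ('a \<Rightarrow> 'b::minus) \<Rightarrow> 'a \<Rightarrow> 'b" where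
  "fdiff s f x = f (x + s) - f x"

lemma fdiff_pow_Suc: "(fdiff s ^^ Suc k) f = (fdiff s ^^ k) (fdiff s f)"
  by (simp add: funpow_swap1)

lemma fdiff_pow_abs_le:
  fixes f :: "'a::semiring_1 \<Rightarrow> real"
  assumes "\<And>i. i \<le> k \<Longrightarrow> \<bar>f (x + of_nat i * s)\<bar> \<le> K"
  shows "\<bar>(fdiff s ^^ k) f x\<bar> \<le> 2 ^ k * K"
  using assms
proof (induction k arbitrary: f K)
  case (Suc k)
  have "\<bar>fdiff s f (x + of_nat i * s)\<bar> \<le> 2 * K" if "i \<le> k" for i
    using Suc.prems[of i] Suc.prems[of "Suc i"] that
    by (simp add: fdiff_def algebra_simps)
  from Suc.IH[of "fdiff s f", OF this] show ?case
    by (simp add: fdiff_pow_Suc del: funpow.simps)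
qed simp

lemma fdiff_pow_linear:
  fixes f g :: "'a::plus \<Rightarrow> real"
  shows "(fdiff s ^^ k) (\<lambda>x. f x - c * g x) x = (fdiff s ^^ k) f x - c * (fdiff s ^^ k) g x"
proof (induction k arbitrary: x)
  case (Suc k)
  then show ?case by (simp add: fdiff_def algebra_simps)
qed simp

lemma fdiff_pow_of_real:
  fixes f :: "'a::plus \<Rightarrow> real"
  shows "(fdiff s ^^ k) (\<lambda>x. complex_of_real (f x)) x = of_real ((fdiff s ^^ k) f x)"
  by (induction k arbitrary: x) (simp_all add: fdiff_def)

lemma fdiff_pow_grid:
  fixes F :: "real \<Rightarrow> real"
  shows "(fdiff 1 ^^ k) (\<lambda>l::nat. F (\<delta> * real l)) l = (fdiff \<delta> ^^ k) F (\<delta> * real l)"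
  by (induction k arbitrary: l) (simp_all add: fdiff_def algebra_simps)

text \<open>Iterated mean value inequality: the functions \<open>fdiff \<delta> (F i)\<close> again
  form a chain of derivatives, on an interval shortened by \<delta>, and the top one is bounded by
  \<open>K * \<delta>\<close>.\<close>

lemma fdiff_pow_le_derivs:
  fixes F :: "nat \<Rightarrow> real \<Rightarrow> real"
  assumes "\<And>i x. i < k \<Longrightarrow> x \<in> {A..B} \<Longrightarrow> (F i has_real_derivative F (Suc i) x) (at x within {A..B})"
    and "\<And>x. x \<in> {A..B} \<Longrightarrow> \<bar>F k x\<bar> \<le> K" and "0 \<le> \<delta>" "A \<le> x" "x + real k * \<delta> \<le> B"
  shows "\<bar>(fdiff \<delta> ^^ k) (F 0) x\<bar> \<le> K * \<delta> ^ k"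
  using assms
proof (induction k arbitrary: F B K)
  case (Suc k)
  define G where "G i = fdiff \<delta> (F i)" for i
  have "\<bar>(fdiff \<delta> ^^ k) (G 0) x\<bar> \<le> (K * \<delta>) * \<delta> ^ k"
  proof (rule Suc.IH)
    fix i y assume i: "i < k" and y: "y \<in> {A..B - \<delta>}"
    have "(F i has_real_derivative F (Suc i) y) (at y within {A..B - \<delta>})"
      by (rule has_field_derivative_subset[OF Suc.prems(1)]) (use i y \<open>0 \<le> \<delta>\<close> in auto)
    moreover have
        "((\<lambda>z. F i (z + \<delta>)) has_real_derivative F (Suc i) (y + \<delta>)) (at y within {A..B - \<delta>})"
    proof -
      have "(F i has_real_derivative F (Suc i) (y + \<delta>)) (at (y + \<delta>) within (\<lambda>z. z + \<delta>) ` {A..B - \<delta>})"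
        by (rule has_field_derivative_subset[OF Suc.prems(1)]) (use i y \<open>0 \<le> \<delta>\<close> in auto)
      moreover have "((\<lambda>z. z + \<delta>) has_real_derivative 1) (at y within {A..B - \<delta>})"
        by (auto intro!: derivative_eq_intros)
      ultimately show ?thesis
        using DERIV_image_chain[of "F i" "F (Suc i) (y + \<delta>)" "\<lambda>z. z + \<delta>" y "{A..B - \<delta>}" 1]
          by (simp add: o_def)
    qed
    ultimately show "(G i has_real_derivative G (Suc i) y) (at y within {A..B - \<delta>})"
      unfolding G_def fdiff_def by (intro derivative_intros)
  next
    fix y assume y: "y \<in> {A..B - \<delta>}"
    have "\<bar>F k (y + \<delta>) - F k y\<bar> \<le> K * \<bar>(y + \<delta>) - y\<bar>"
      unfolding real_norm_def[symmetric]
      by (rule field_differentiable_bound[of "{A..B}" "F k" "F (Suc k)"])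
         (use Suc.prems y in auto)
    then show "\<bar>G k y\<bar> \<le> K * \<delta>" using Suc.prems by (simp add: G_def fdiff_def)
  qed (use Suc.prems in \<open>auto simp: algebra_simps\<close>)
  then show ?case by (simp add: fdiff_pow_Suc G_def del: funpow.simps)
qed simp

text \<open>A discrete C^k bound at grid scale \<open>q\<close>. Only differences whose whole
  stencil \<open>l, ..., l + i\<close> lies in the window count, and all orders share one constant,
  which makes the notion stable under products.\<close>

definition fdiff_bounded :: "nat \<Rightarrow> nat \<Rightarrow> real \<Rightarrow> nat \<Rightarrow> real \<Rightarrow> (nat \<Rightarrow> real) \<Rightarrow> bool" where
  "fdiff_bounded lo hi q k K f \<longleftrightarrow>
     (\<forall>i\<le>k. \<forall>l\<ge>lo. l + i \<le> hi \<longrightarrow> \<bar>(fdiff 1 ^^ i) f l\<bar> \<le> K * q ^ i)"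

lemma fdiff_bounded_mono:
  assumes "fdiff_bounded lo hi q k K f" "lo \<le> lo'" "hi' \<le> hi" "k' \<le> k" "K \<le> K'" "0 \<le> q"
  shows "fdiff_bounded lo' hi' q k' K' f"
  unfolding fdiff_bounded_def
proof (intro allI impI)
  fix i l assume *: "i \<le> k'" "lo' \<le> l" "l + i \<le> hi'"
  have "\<bar>(fdiff 1 ^^ i) f l\<bar> \<le> K * q ^ i"
    using assms * unfolding fdiff_bounded_def by auto
  also have "\<dots> \<le> K' * q ^ i" using assms by (intro mult_right_mono) auto
  finally show "\<bar>(fdiff 1 ^^ i) f l\<bar> \<le> K' * q ^ i" .
qed

lemma fdiff_bounded_fdiff:
  assumes "fdiff_bounded lo (Suc hi) q (Suc k) K f"
  shows "fdiff_bounded lo hi q k (K * q) (fdiff 1 f)"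
  unfolding fdiff_bounded_def
proof (intro allI impI)
  fix i l assume "i \<le> k" "lo \<le> l" "l + i \<le> hi"
  then have "\<bar>(fdiff 1 ^^ Suc i) f l\<bar> \<le> K * q ^ Suc i"
    using assms unfolding fdiff_bounded_def by (metis Suc_le_mono add_Suc_right)
  then show "\<bar>(fdiff 1 ^^ i) (fdiff 1 f) l\<bar> \<le> K * q * q ^ i"
    by (simp add: fdiff_pow_Suc mult.assoc del: funpow.simps)
qed

lemma fdiff_bounded_shift:
  assumes "fdiff_bounded lo (Suc hi) q k K f"
  shows "fdiff_bounded lo hi q k K (\<lambda>l. f (Suc l))"
proof -
  have "(fdiff 1 ^^ i) (\<lambda>l. f (Suc l)) l = (fdiff 1 ^^ i) f (Suc l)" for i l
    by (induction i arbitrary: l) (simp_all add: fdiff_def)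
  then show ?thesis using assms unfolding fdiff_bounded_def by auto
qed

text \<open>Discrete Leibniz rule. Differencing a product once gives two products, each with one
  differenced factor that contributes an extra \<open>q\<close>; hence the constant doubles with
  every order.\<close>

lemma fdiff_pow_mult_le:
  assumes "fdiff_bounded lo hi q k K f" "fdiff_bounded lo hi q k L g"
    and "lo \<le> l" "l + k \<le> hi" "0 \<le> q"
  shows "\<bar>(fdiff 1 ^^ k) (\<lambda>l. f l * g l) l\<bar> \<le> 2 ^ k * K * L * q ^ k"
  using assms
proof (induction k arbitrary: hi f g K L)
  case 0
  then have "\<bar>f l\<bar> \<le> K" "\<bar>g l\<bar> \<le> L" by (auto simp: fdiff_bounded_def)
  then show ?case by (simp add: abs_mult mult_mono')
next
  case (Suc k)
  then obtain hi' where hi: "hi = Suc hi'" by (cases hi) auto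
  note b = Suc.prems(1,2)[unfolded hi]
  have b': "fdiff_bounded lo hi' q k K f" "fdiff_bounded lo (Suc hi') q k L g"
    by (rule fdiff_bounded_mono[OF b(1)] fdiff_bounded_mono[OF b(2)]; use Suc.prems in simp)+
  \<comment> \<open>The sum is written as a difference with scalar -1 to match
    \<open>fdiff_pow_linear\<close>.\<close>
  have "fdiff 1 (\<lambda>l. f l * g l) = (\<lambda>l. fdiff 1 f l * g (Suc l) - (-1) * (f l * fdiff 1 g l))"
    by (auto simp: fdiff_def algebra_simps)
  then have "(fdiff 1 ^^ Suc k) (\<lambda>l. f l * g l) l =
      (fdiff 1 ^^ k) (\<lambda>l. fdiff 1 f l * g (Suc l)) l + (fdiff 1 ^^ k) (\<lambda>l. f l * fdiff 1 g l) l"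
    using fdiff_pow_linear[of k 1 "\<lambda>l. fdiff 1 f l * g (Suc l)" "-1" "\<lambda>l. f l * fdiff 1 g l" l]
    by (simp add: fdiff_pow_Suc del: funpow.simps)
  moreover have "\<bar>(fdiff 1 ^^ k) (\<lambda>l. fdiff 1 f l * g (Suc l)) l\<bar> \<le> 2 ^ k * (K * q) * L * q ^ k"
    by (rule Suc.IH[OF fdiff_bounded_fdiff[OF b(1)] fdiff_bounded_shift[OF b'(2)]])
       (use Suc.prems hi in auto)
  moreover have "\<bar>(fdiff 1 ^^ k) (\<lambda>l. f l * fdiff 1 g l) l\<bar> \<le> 2 ^ k * K * (L * q) * q ^ k"
    by (rule Suc.IH[OF b'(1) fdiff_bounded_fdiff[OF b(2)]]) (use Suc.prems hi in auto)
  ultimately show ?case by (simp add: algebra_simps)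
qed

lemma fdiff_bounded_mult:
  assumes "fdiff_bounded lo hi q k K f" "fdiff_bounded lo hi q k L g" "0 \<le> q" "0 \<le> K" "0 \<le> L"
  shows "fdiff_bounded lo hi q k (2 ^ k * K * L) (\<lambda>l. f l * g l)"
  unfolding fdiff_bounded_def
proof (intro allI impI)
  fix i l assume *: "i \<le> k" "lo \<le> l" "l + i \<le> hi"
  have "\<bar>(fdiff 1 ^^ i) (\<lambda>l. f l * g l) l\<bar> \<le> 2 ^ i * K * L * q ^ i"
    by (rule fdiff_pow_mult_le[where lo = lo and hi = hi];
        (rule fdiff_bounded_mono[OF assms(1)] fdiff_bounded_mono[OF assms(2)])?;
        use * assms in simp)
  also have "\<dots> \<le> 2 ^ k * K * L * q ^ i"
    using * assms by (intro mult_right_mono) (auto intro: power_increasing)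
  finally show "\<bar>(fdiff 1 ^^ i) (\<lambda>l. f l * g l) l\<bar> \<le> 2 ^ k * K * L * q ^ i" .
qed

section \<open>Differences of intermediate order\<close>

definition block_sum :: "nat \<Rightarrow> (nat \<Rightarrow> real) \<Rightarrow> nat \<Rightarrow> real" where
  "block_sum m f l = (\<Sum>i<m. f (l + i))"

lemma fdiff_eq_block_sum: "fdiff m f = block_sum m (fdiff 1 f)"
proof
  fix l
  show "fdiff m f l = block_sum m (fdiff 1 f) l"
    using sum_lessThan_telescope[of "\<lambda>i. f (l + i)" m] by (simp add: fdiff_def block_sum_def)
qed

lemma fdiff_block_sum: "fdiff 1 (block_sum m f) = block_sum m (fdiff 1 f)"
  by (auto simp: fdiff_def block_sum_def sum_subtractf)

text \<open>A difference with step \<open>m\<close> telescopes into a block of unit differences, and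
  block sums commute with \<open>fdiff 1\<close>, so the two operations can be separated.\<close>

lemma fdiff_pow_eq_block_sum: "(fdiff m ^^ k) f = (block_sum m ^^ k) ((fdiff 1 ^^ k) f)"
proof -
  have *: "fdiff 1 ((block_sum m ^^ k) f) = (block_sum m ^^ k) (fdiff 1 f)" for k f
    by (induction k) (simp_all only: funpow.simps comp_def id_apply fdiff_block_sum)
  show ?thesis
    by (induction k) (simp_all only: funpow.simps comp_def id_apply fdiff_eq_block_sum[of m] *)
qed

text \<open>The iterated block sum adds \<open>m ^ k\<close> values of \<open>f\<close>, at indices
  from \<open>l\<close> to \<open>l + k * (m - 1)\<close>, each within \<open>e\<close> of
  \<open>a\<close>.\<close>

lemma block_sum_pow_approx:
  assumes "\<And>i. i \<le> k * (m - 1) \<Longrightarrow> \<bar>f (l + i) - a\<bar> \<le> e"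
  shows "\<bar>(block_sum m ^^ k) f l - real m ^ k * a\<bar> \<le> real m ^ k * e"
  using assms
proof (induction k arbitrary: l)
  case (Suc k)
  have *: "\<bar>(block_sum m ^^ k) f (l + i) - real m ^ k * a\<bar> \<le> real m ^ k * e" if "i < m" for i
  proof (rule Suc.IH)
    fix j assume "j \<le> k * (m - 1)"
    then show "\<bar>f (l + i + j) - a\<bar> \<le> e"
      using Suc.prems[of "i + j"] that by (simp add: add.assoc)
  qed
  have "(block_sum m ^^ Suc k) f l - real m ^ Suc k * a =
      (\<Sum>i<m. (block_sum m ^^ k) f (l + i) - real m ^ k * a)"
    by (simp add: block_sum_def sum_subtractf)
  also have "\<bar>\<dots>\<bar> \<le> (\<Sum>i<m. real m ^ k * e)"
    by (rule order_trans[OF sum_abs sum_mono]) (use * in auto)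
  finally show ?case by simp
qed (use assms in auto)

text \<open>If the differences of order \<open>k + 1\<close> are small, those of order \<open>k\<close> are nearly constant, so a
  difference of order \<open>k\<close> with large step \<open>m\<close>, which is bounded, is nearly \<open>m\<^sup>k\<close> times their value.\<close>

lemma fdiff_pow_le_interpolate:
  assumes f: "\<And>l. lo \<le> l \<Longrightarrow> l \<le> lo + n \<Longrightarrow> \<bar>f l\<bar> \<le> K"
    and Df: "\<And>l. lo \<le> l \<Longrightarrow> l + Suc k \<le> lo + n \<Longrightarrow> \<bar>(fdiff 1 ^^ Suc k) f l\<bar> \<le> B / real n ^ Suc k"
    and k: "0 < k" "k \<le> n" and l: "lo \<le> l" "l + k \<le> lo + n" and "0 \<le> K" "0 \<le> B"
  shows "\<bar>(fdiff 1 ^^ k) f l\<bar> \<le> ((4 * real k) ^ k * K + 2 * B) / real n ^ k"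
proof -
  define g where "g = (fdiff 1 ^^ k) f"
  \<comment> \<open>The largest step for which a stencil of order \<open>k\<close> fits into length
    \<open>n\<close>. Rounding down costs at most a factor 2, that is
    \<open>n \<le> 2 * k * m\<close>, which later turns \<open>2 ^ k * K / m ^ k\<close> into
    \<open>(4 * k) ^ k * K / n ^ k\<close>.\<close>
  define m where "m = n div k"
  have m: "m \<ge> 1" "m * k \<le> n" using k by (auto simp: m_def Suc_le_eq div_greater_zero_iff)
  have "n < k * (m + 1)" 
    using dividend_less_times_div[of k n] k by (simp add: m_def)
  also have "\<dots> \<le> 2 * k * m" using m by (cases m) auto
  finally have "real n \<le> real (2 * k * m)" by (intro of_nat_mono) simp
  then have mn: "real n \<le> 2 * real k * real m" by simp
  have n: "n > 0" using k by auto
  define q where "q = B / real n ^ Suc k"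
  have g: "\<bar>g (lo + i) - g lo\<bar> \<le> real i * q" if "i + k \<le> n" for i
    using that
  proof (induction i)
    case (Suc i)
    have "\<bar>g (lo + Suc i) - g (lo + i)\<bar> \<le> q"
      using Df[of "lo + i"] Suc.prems by (simp add: g_def fdiff_def q_def)
    moreover have "\<bar>g (lo + i) - g lo\<bar> \<le> real i * q" by (rule Suc.IH) (use Suc.prems in simp)
    ultimately have "\<bar>g (lo + Suc i) - g lo\<bar> \<le> q + real i * q"
      by linarith
    then show ?case by (simp add: algebra_simps)
  qed simp
  have g': "\<bar>g (lo + i) - g lo\<bar> \<le> B / real n ^ k" if "i + k \<le> n" for i
  proof -
    have "real i * q \<le> real n * q"
      unfolding q_def using that \<open>0 \<le> B\<close> by (intro mult_right_mono) auto
    also have "\<dots> = B / real n ^ k" using n by (simp add: q_def)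
    finally show ?thesis using g[OF that] by linarith
  qed
  have "\<bar>(fdiff m ^^ k) f lo - real m ^ k * g lo\<bar> \<le> real m ^ k * (B / real n ^ k)"
    unfolding fdiff_pow_eq_block_sum[where m = m] g_def[symmetric]
  proof (rule block_sum_pow_approx)
    fix i assume i: "i \<le> k * (m - 1)"
    then have "i + k \<le> n" using m by (cases m) (auto simp: algebra_simps)
    then show "\<bar>g (lo + i) - g lo\<bar> \<le> B / real n ^ k" by (rule g')
  qed
  moreover have "\<bar>(fdiff m ^^ k) f lo\<bar> \<le> 2 ^ k * K"
  proof (rule fdiff_pow_abs_le)
    fix i assume "i \<le> k"
    then have "i * m \<le> n" using m(2) order_trans[OF mult_le_mono1, of i k m n]
      by (simp add: mult.commute)
    then show "\<bar>f (lo + of_nat i * m)\<bar> \<le> K" by (intro f) auto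
  qed
  ultimately have "\<bar>real m ^ k * g lo\<bar> \<le> 2 ^ k * K + real m ^ k * (B / real n ^ k)" by linarith
  then have "real m ^ k * \<bar>g lo\<bar> \<le> 2 ^ k * K + real m ^ k * (B / real n ^ k)"
    by (simp add: abs_mult)
  also have "\<dots> = real m ^ k * (2 ^ k * K / real m ^ k + B / real n ^ k)" using m
    by (simp add: distrib_left)
  finally have "\<bar>g lo\<bar> \<le> 2 ^ k * K / real m ^ k + B / real n ^ k" using m by simp
  moreover have "2 ^ k * K / real m ^ k \<le> (4 * real k) ^ k * K / real n ^ k"
  proof -
    have "real n ^ k \<le> (2 * real k * real m) ^ k" using mn by (intro power_mono) auto
    then have "2 ^ k * K * real n ^ k \<le> 2 ^ k * K * (2 * real k * real m) ^ k"
      using \<open>0 \<le> K\<close> by (intro mult_left_mono) auto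
    also have "(2 * real k * real m) ^ k = (2 * real k) ^ k * real m ^ k"
      by (rule power_mult_distrib)
    also have "2 ^ k * K * ((2 * real k) ^ k * real m ^ k)
        = (2 ^ k * (2 * real k) ^ k) * K * real m ^ k"
      by (simp only: mult_ac)
    also have "2 ^ k * (2 * real k) ^ k = (4 * real k) ^ k"
      by (simp only: power_mult_distrib[symmetric] mult.assoc[symmetric] arith_simps)
    finally have *: "2 ^ k * K * real n ^ k \<le> (4 * real k) ^ k * K * real m ^ k" .
    have "0 < real m ^ k" "0 < real n ^ k" using m n by auto
    then show ?thesis
      by (simp only: pos_divide_le_eq times_divide_eq_left pos_le_divide_eq *)
  qed
  \<comment> \<open>The second \<open>B\<close>: the first came from comparing the coarse difference
    with \<open>g lo\<close>, this one from moving from \<open>lo\<close> to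
    \<open>l\<close>.\<close>
  moreover have "\<bar>g l - g lo\<bar> \<le> B / real n ^ k" using g'[of "l - lo"] l by simp
  ultimately have "\<bar>g l\<bar> \<le> (4 * real k) ^ k * K / real n ^ k + 2 * (B / real n ^ k)" by linarith
  then show ?thesis by (simp add: g_def add_divide_distrib)
qed

text \<open>A discrete Landau-Kolmogorov inequality. Bounds on orders 0 and M + 1 give one on order
  M with a worse constant, and the induction hypothesis handles the orders below. \<open>L\<close>
  is chosen before \<open>f\<close>, the position and the length of the window, which yields
  uniformity in N.\<close>

lemma fdiff_pow_intermediate:
  assumes "0 \<le> K" "0 \<le> B"
  obtains L where "0 \<le> L"
    "\<And>f lo n. M \<le> n \<Longrightarrow> (\<And>l. lo \<le> l \<Longrightarrow> l \<le> lo + n \<Longrightarrow> \<bar>f l\<bar> \<le> K) \<Longrightarrow>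
       (\<And>l. lo \<le> l \<Longrightarrow> l + M \<le> lo + n \<Longrightarrow> \<bar>(fdiff 1 ^^ M) f l\<bar> \<le> B / real n ^ M) \<Longrightarrow>
       fdiff_bounded lo (lo + n) (1 / real n) M L f"
proof -
  have "\<exists>L\<ge>0. \<forall>f lo n. M \<le> n \<longrightarrow> (\<forall>l. lo \<le> l \<longrightarrow> l \<le> lo + n \<longrightarrow> \<bar>f l\<bar> \<le> K) \<longrightarrow>
       (\<forall>l. lo \<le> l \<longrightarrow> l + M \<le> lo + n \<longrightarrow> \<bar>(fdiff 1 ^^ M) f l\<bar> \<le> B / real n ^ M) \<longrightarrow>
       fdiff_bounded lo (lo + n) (1 / real n) M L f"
    using \<open>0 \<le> B\<close>
  proof (induction M arbitrary: B)
    case 0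
    show ?case by (rule exI[of _ K]) (use \<open>0 \<le> K\<close> in \<open>simp add: fdiff_bounded_def\<close>)
  next
    case (Suc M)
    define B' where "B' = (4 * real M) ^ M * K + 2 * B"
    have "0 \<le> B'" using \<open>0 \<le> K\<close> \<open>0 \<le> B\<close> by (simp add: B'_def)
    from Suc.IH[OF this] obtain L where L: "L \<ge> 0"
      "\<And>f lo n. M \<le> n \<Longrightarrow> \<forall>l. lo \<le> l \<longrightarrow> l \<le> lo + n \<longrightarrow> \<bar>f l\<bar> \<le> K \<Longrightarrow>
       \<forall>l. lo \<le> l \<longrightarrow> l + M \<le> lo + n \<longrightarrow> \<bar>(fdiff 1 ^^ M) f l\<bar> \<le> B' / real n ^ M \<Longrightarrow>
       fdiff_bounded lo (lo + n) (1 / real n) M L f" by blast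
    show ?case
    proof (intro exI[of _ "max L B"] conjI allI impI)
      fix f :: "nat \<Rightarrow> real" and lo n
      assume n: "Suc M \<le> n" and f: "\<forall>l. lo \<le> l \<longrightarrow> l \<le> lo + n \<longrightarrow> \<bar>f l\<bar> \<le> K"
        and Df: "\<forall>l. lo \<le> l \<longrightarrow> l + Suc M \<le> lo + n \<longrightarrow> \<bar>(fdiff 1 ^^ Suc M) f l\<bar> \<le> B / real n ^ Suc M"
      have "\<forall>l. lo \<le> l \<longrightarrow> l + M \<le> lo + n \<longrightarrow> \<bar>(fdiff 1 ^^ M) f l\<bar> \<le> B' / real n ^ M"
      proof (cases "M = 0")
        case True
        \<comment> \<open>Interpolation needs positive order. At order 0 the bound on
          \<open>f\<close> itself suffices: \<open>(4 * 0) ^ 0 = 1\<close>, so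
          \<open>B' = K + 2 * B\<close>.\<close>
        have "K \<le> B'" using True \<open>0 \<le> B\<close> by (simp add: B'_def)
        then show ?thesis using f True by force
      next
        case False
        show ?thesis unfolding B'_def
          by (intro allI impI fdiff_pow_le_interpolate) (use f Df n False \<open>0 \<le> K\<close> \<open>0 \<le> B\<close> in auto)
      qed
      then have *: "fdiff_bounded lo (lo + n) (1 / real n) M L f" using L(2) n f by simp
      show "fdiff_bounded lo (lo + n) (1 / real n) (Suc M) (max L B) f"
        unfolding fdiff_bounded_def
      proof (intro allI impI)
        fix i l assume i: "i \<le> Suc M" and l: "lo \<le> l" "l + i \<le> lo + n"
        show "\<bar>(fdiff 1 ^^ i) f l\<bar> \<le> max L B * (1 / real n) ^ i"
        proof (cases "i = Suc M")
          case True
          then have "\<bar>(fdiff 1 ^^ i) f l\<bar> \<le> B * (1 / real n) ^ i"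
            using Df l by (simp add: power_one_over field_simps)
          also have "\<dots> \<le> max L B * (1 / real n) ^ i" by (intro mult_right_mono) auto
          finally show ?thesis .
        next
          case False
          then have "\<bar>(fdiff 1 ^^ i) f l\<bar> \<le> L * (1 / real n) ^ i"
            using * l i unfolding fdiff_bounded_def by auto
          also have "\<dots> \<le> max L B * (1 / real n) ^ i" by (intro mult_right_mono) auto
          finally show ?thesis .
        qed
      qed
    qed (use L in simp)
  qed
  then show ?thesis using that by blast
qed

section \<open>Summation by parts\<close>

text \<open>The zeros of \<open>f\<close> at both ends remove all boundary terms. Each difference
  uses up one of the \<open>M\<close> leading zeros; the factor \<open>z ^ M\<close> undoes the
  index shifts without dividing by \<open>z\<close>.\<close>

lemma sum_by_parts_pow:
  fixes f :: "nat \<Rightarrow> complex"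
  assumes "\<And>l. l < M \<Longrightarrow> f l = 0" "\<And>l. L \<le> l \<Longrightarrow> f l = 0"
  shows "(\<Sum>l<L. (fdiff 1 ^^ M) f l * z ^ l) * z ^ M = (1 - z) ^ M * (\<Sum>l<L. f l * z ^ l)"
  using assms
proof (induction M arbitrary: f)
  case (Suc M)
  have "(\<Sum>l<L. fdiff 1 f l * z ^ l) * z = (\<Sum>l<L. f (Suc l) * z ^ Suc l) - z * (\<Sum>l<L. f l * z ^ l)"
    by (simp add: fdiff_def sum_distrib_left sum_distrib_right algebra_simps sum_subtractf)
  also have "(\<Sum>l<L. f (Suc l) * z ^ Suc l) = (\<Sum>l<Suc L. f l * z ^ l)"
    using Suc.prems(1)[of 0] by (simp add: sum.lessThan_Suc_shift del: sum.lessThan_Suc)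
  also have "\<dots> = (\<Sum>l<L. f l * z ^ l)" using Suc.prems(2)[of L] by simp
  finally have *: "(\<Sum>l<L. fdiff 1 f l * z ^ l) * z = (1 - z) * (\<Sum>l<L. f l * z ^ l)"
    by (simp add: algebra_simps)
  have "(\<Sum>l<L. (fdiff 1 ^^ Suc M) f l * z ^ l) * z ^ Suc M
      = ((\<Sum>l<L. (fdiff 1 ^^ M) (fdiff 1 f) l * z ^ l) * z ^ M) * z"
    by (simp only: fdiff_pow_Suc power_Suc2 mult.assoc)
  also have "\<dots> = (1 - z) ^ M * (\<Sum>l<L. fdiff 1 f l * z ^ l) * z"
    by (subst Suc.IH) (use Suc.prems in \<open>auto simp: fdiff_def\<close>)
  also have "\<dots> = (1 - z) ^ M * ((\<Sum>l<L. fdiff 1 f l * z ^ l) * z)" by (simp only: mult.assoc)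
  also have "\<dots> = (1 - z) ^ Suc M * (\<Sum>l<L. f l * z ^ l)" unfolding * by simp
  finally show ?case .
qed simp

lemma norm_trig_sum_le:
  fixes f :: "nat \<Rightarrow> real"
  assumes "\<And>l. l < M \<Longrightarrow> f l = 0" "\<And>l. L \<le> l \<Longrightarrow> f l = 0" and z: "cmod z = 1"
  shows "cmod (1 - z) ^ M * cmod (\<Sum>l<L. of_real (f l) * z ^ l) \<le> (\<Sum>l<L. \<bar>(fdiff 1 ^^ M) f l\<bar>)"
proof -
  have "cmod (1 - z) ^ M * cmod (\<Sum>l<L. of_real (f l) * z ^ l) =
      cmod ((\<Sum>l<L. (fdiff 1 ^^ M) (\<lambda>l. complex_of_real (f l)) l * z ^ l) * z ^ M)"
    by (subst sum_by_parts_pow) (use assms in \<open>auto simp: norm_mult norm_power\<close>)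
  also have "\<dots> = cmod (\<Sum>l<L. of_real ((fdiff 1 ^^ M) f l) * z ^ l)"
    using z by (simp add: norm_mult norm_power fdiff_pow_of_real)
  also have "\<dots> \<le> (\<Sum>l<L. \<bar>(fdiff 1 ^^ M) f l\<bar>)"
    by (rule sum_norm_le) (use z in \<open>simp add: norm_mult norm_power\<close>)
  finally show ?thesis .
qed

section \<open>Differences and weak derivatives\<close>

lemma smooth_has_deriv:
  assumes "smooth f"
  shows "((deriv ^^ n) f has_real_derivative (deriv ^^ Suc n) f x) (at x)"
  using assms by (simp add: smooth_def DERIV_deriv_iff_field_differentiable)

lemma smooth_continuous_on: "smooth f \<Longrightarrow> continuous_on S ((deriv ^^ n) f)"
  by (meson DERIV_isCont continuous_at_imp_continuous_on smooth_has_deriv)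

lemma deriv_pow_affine:
  assumes "smooth f"
  shows "(deriv ^^ n) (\<lambda>x. f (c * x + b)) = (\<lambda>x. c ^ n * (deriv ^^ n) f (c * x + b))"
proof (induction n)
  case (Suc n)
  have "((\<lambda>x. c ^ n * (deriv ^^ n) f (c * x + b)) has_real_derivative
      c ^ Suc n * (deriv ^^ Suc n) f (c * x + b)) (at x)" for x
    by (rule derivative_eq_intros DERIV_chain2[OF smooth_has_deriv[OF assms]] refl)+ simp
  then have "deriv (\<lambda>x. c ^ n * (deriv ^^ n) f (c * x + b)) =
      (\<lambda>x. c ^ Suc n * (deriv ^^ Suc n) f (c * x + b))"
    by (intro ext DERIV_imp_deriv)
  then show ?case by (simp add: Suc.IH)
qed simp

lemma smooth_affine:
  assumes "smooth f"
  shows "smooth (\<lambda>x. f (c * x + b))"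
  unfolding smooth_def deriv_pow_affine[OF assms]
proof (intro allI)
  fix n x
  have "((\<lambda>x. c ^ n * (deriv ^^ n) f (c * x + b)) has_real_derivative
      c ^ Suc n * (deriv ^^ Suc n) f (c * x + b)) (at x)"
    by (rule derivative_eq_intros DERIV_chain2[OF smooth_has_deriv[OF assms]] refl)+ simp
  then show "(\<lambda>x. c ^ n * (deriv ^^ n) f (c * x + b)) field_differentiable at x"
    unfolding field_differentiable_def by blast
qed

text \<open>Connects the Lebesgue integral over the open interval in \<open>has_weak_deriv\<close>
  with the gauge integral over the closed one, to which \<open>leibniz_rule_field_derivative\<close>
  applies.\<close>

lemma set_integral_open_eq_integral:
  fixes f :: "real \<Rightarrow> real"
  assumes "continuous_on {A..B} f"
  shows "(LINT x:{A<..<B}|lebesgue. f x) = integral {A..B} f"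
proof -
  have "set_integrable lebesgue {A<..<B} f"
    using absolutely_integrable_continuous_real[OF assms] by (rule set_integrable_subset) auto
  then show ?thesis
    by (simp add: set_lebesgue_integral_eq_integral integral_open_interval_real)
qed

text \<open>Convolution with a rescaled bump \<open>\<phi>\<close> turns the weak derivative into a classical one.\<close>

lemma weak_deriv_fdiff_le:
  assumes h: "has_weak_deriv M {A..B} h v" and M: "0 < M"
    and v: "\<And>x. x \<in> {A..B} \<Longrightarrow> \<bar>v x\<bar> \<le> K"
    and \<phi>: "smooth \<phi>" "\<And>\<xi>. 0 \<le> \<phi> \<xi>" "\<And>\<xi>. \<bar>\<xi>\<bar> > 1 \<Longrightarrow> \<phi> \<xi> = 0" "\<phi> 0 \<noteq> 0"
    and x: "A < x" "x + real M * \<delta> < B" and \<delta>: "0 \<le> \<delta>"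
  shows "\<bar>(fdiff \<delta> ^^ M) h x\<bar> \<le> K * \<delta> ^ M"
proof (rule field_le_epsilon)
  fix \<kappa>' :: real assume "0 < \<kappa>'"
  \<comment> \<open>A difference of order \<open>M\<close> magnifies pointwise errors by up to
    \<open>2 ^ M\<close>.\<close>
  define \<kappa> where "\<kappa> = \<kappa>' / 2 ^ M"
  have "\<kappa> > 0" using \<open>0 < \<kappa>'\<close> by (simp add: \<kappa>_def)
  have M\<delta>: "0 \<le> real M * \<delta>" using \<delta> by simp
  have AB: "A < B" using x M\<delta> by linarith
  have K: "0 \<le> K" using v[of A] AB by force
  \<comment> \<open>The continuity clause of \<open>has_weak_deriv\<close> at positive order is what
    lets averages determine point values of \<open>h\<close>.\<close>
  have hc: "continuous_on {A..B} h" using h M by (simp add: has_weak_deriv_def)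
  obtain d where d: "d > 0" "\<And>s t. s \<in> {A..B} \<Longrightarrow> t \<in> {A..B} \<Longrightarrow> \<bar>s - t\<bar> < d \<Longrightarrow> \<bar>h s - h t\<bar> < \<kappa>"
    using compact_uniformly_continuous[OF hc compact_Icc] \<open>\<kappa> > 0\<close>
    unfolding uniformly_continuous_on_def dist_real_def by metis
  \<comment> \<open>The bump radius: below \<open>d\<close>, so that \<open>h\<close> varies by less
    than \<kappa> over a bump, and small enough that bumps centred anywhere on the stencil stay
    inside \<open>{A..B}\<close>.\<close>
  define \<epsilon> where "\<epsilon> = min (d / 2) (min ((x - A) / 2) ((B - (x + real M * \<delta>)) / 2))"
  have \<epsilon>: "\<epsilon> > 0" "\<epsilon> < d" "A + \<epsilon> < x" "x + real M * \<delta> < B - \<epsilon>"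
    using d x by (auto simp: \<epsilon>_def min_def field_simps)
  define \<rho> where "\<rho> u y = \<phi> (1 / \<epsilon> * y + (- u / \<epsilon>))" for u y
  have \<rho>_smooth: "smooth (\<rho> u)" for u unfolding \<rho>_def by (rule smooth_affine[OF \<phi>(1)])
  have \<rho>_nonneg: "0 \<le> \<rho> u y" for u y by (simp add: \<rho>_def \<phi>)
  have \<rho>_zero: "\<rho> u y = 0" if "\<bar>y - u\<bar> > \<epsilon>" for u y
  proof -
    have "\<bar>(y - u) / \<epsilon>\<bar> > 1" using that \<epsilon> by (simp add: abs_divide)
    then show ?thesis by (simp add: \<rho>_def \<phi>(3) diff_divide_distrib)
  qed
  have \<rho>_cont: "continuous_on S (\<rho> u)" for S u using smooth_continuous_on[OF \<rho>_smooth, where n=0]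
    by simp
  define D where "D k u y = (1 / \<epsilon>) ^ k * (deriv ^^ k) \<phi> (1 / \<epsilon> * y + (- u / \<epsilon>))" for k u y
  have D: "(deriv ^^ k) (\<rho> u) = D k u" for k u
    unfolding \<rho>_def D_def by (rule deriv_pow_affine[OF \<phi>(1)])
  \<comment> \<open>\<open>F k\<close> is the \<open>k\<close>-th derivative in \<open>u\<close> of
    the convolution \<open>F 0\<close>. \<open>D\<close> differentiates the bump in
    \<open>y\<close>; a derivative in the centre \<open>u\<close> has the opposite sign, hence
    \<open>(-1) ^ k\<close>.\<close>
  define F where "F k u = integral {A..B} (\<lambda>y. (-1) ^ k * (h y * D k u y))" for k u
  have contD2: "continuous_on S (\<lambda>z. D k (fst z) (snd z))" for k S
    unfolding D_def
    by (intro continuous_intros continuous_on_compose2[OF smooth_continuous_on[OF \<phi>(1), where S=UNIV]]) (use \<epsilon> in auto)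
  have contD: "continuous_on S (D k u)" for k u S
    using continuous_on_compose2[OF contD2[of UNIV k], of S
        "\<lambda>y. (u, y)"] continuous_on_Pair[OF continuous_on_const continuous_on_id] by auto
  have F: "(F k has_real_derivative F (Suc k) u) (at u)" for k u
    unfolding F_def box_real(2)[symmetric]
  proof (rule leibniz_rule_field_derivative[where U = UNIV])
    fix u y :: real
    have "((\<lambda>u. D k u y) has_real_derivative - D (Suc k) u y) (at u)"
    proof -
      have "((\<lambda>u. 1 / \<epsilon> * y + (- u / \<epsilon>)) has_real_derivative - (1 / \<epsilon>)) (at u)"
        using \<epsilon> by (auto intro!: derivative_eq_intros)
      from DERIV_cmult[OF DERIV_chain2[OF smooth_has_deriv[OF \<phi>(1)] this], of "(1 / \<epsilon>) ^ k" k]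
      show ?thesis by (simp add: D_def mult_ac)
    qed
    then show "((\<lambda>u. (-1) ^ k * (h y * D k u y)) has_real_derivative (-1) ^ Suc k * (h y * D (Suc k) u y)) (at u)"
      by (auto intro!: derivative_eq_intros)
  next
    fix u
    show "(\<lambda>y. (-1) ^ k * (h y * D k u y)) integrable_on cbox A B"
      by (intro integrable_continuous continuous_intros contD) (use hc in simp)
  next
    have "continuous_on (UNIV \<times> cbox A B) (\<lambda>z::real\<times>real. h (snd z))"
      by (rule continuous_on_compose2[OF hc]) (auto intro!: continuous_intros)
    then show "continuous_on (UNIV \<times> cbox A B) (\<lambda>(u, y). (-1) ^ Suc k * (h y * D (Suc k) u y))"
      unfolding case_prod_beta by (intro continuous_intros contD2)
  qed auto
  \<comment> \<open>The bump is not normalised: its mass \<open>m\<close> is carried along and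
    cancelled at the end.\<close>
  define m where "m = integral {-\<epsilon>..\<epsilon>} (\<rho> 0)"
  have \<rho>_int: "integral {A..B} (\<rho> u) = m" if "A + \<epsilon> \<le> u" "u \<le> B - \<epsilon>" for u
  proof -
    have "integral {A..B} (\<rho> u) = integral {u-\<epsilon>..u+\<epsilon>} (\<rho> u)"
    proof (rule integral_unique, rule has_integral_on_superset)
      show "(\<rho> u has_integral integral {u-\<epsilon>..u+\<epsilon>} (\<rho> u)) {u-\<epsilon>..u+\<epsilon>}"
        by (intro integrable_integral integrable_continuous_real \<rho>_cont)
    qed (use that \<rho>_zero[of _ u] in force)+
    also have "\<dots> = integral {-\<epsilon>+u..\<epsilon>+u} (\<rho> u)" by (simp add: algebra_simps)
    also have "\<dots> = integral {-\<epsilon>..\<epsilon>} (\<rho> u \<circ> (+) u)" by (rule integral_shift_Icc_real[symmetric])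
    also have "\<rho> u \<circ> (+) u = \<rho> 0" by (auto simp: \<rho>_def field_simps add_divide_distrib)
    finally show ?thesis by (simp add: m_def)
  qed
  have m: "m > 0"
  proof -
    have "m \<ge> 0" unfolding m_def
      by (intro integral_nonneg integrable_continuous_real \<rho>_cont \<rho>_nonneg)
    moreover have "m \<noteq> 0"
    proof
      assume "m = 0"
      have "(\<rho> 0 has_integral m) (cbox (-\<epsilon>) \<epsilon>)"
        unfolding m_def by (auto intro!: integrable_integral integrable_continuous_real \<rho>_cont)
      then have "\<rho> 0 0 = 0"
        by (intro has_integral_0_cbox_imp_0[of "-\<epsilon>" \<epsilon> "\<rho> 0" 0])
           (use \<open>m = 0\<close> \<rho>_nonneg \<rho>_cont \<epsilon> in auto)
      then show False using \<phi>(4) by (simp add: \<rho>_def)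
    qed
    ultimately show ?thesis by linarith
  qed
  \<comment> \<open>The weak derivative enters here, tested against the bump centred at
    \<open>u\<close>: all \<open>M\<close> derivatives move from the bump to
    \<open>v\<close>.\<close>
  have FM: "\<bar>F M u\<bar> \<le> K * m" if u: "u \<in> {A + \<epsilon><..<B - \<epsilon>}" for u
  proof -
    have "test_function {A<..<B} (\<rho> u)"
      unfolding test_function_def
      by (intro conjI \<rho>_smooth exI[of _ "{u-\<epsilon>..u+\<epsilon>}"]) (use u \<rho>_zero[of _ u] in force)+
    then have "(LINT y:{A<..<B}|lebesgue. h y * (deriv ^^ M) (\<rho> u) y)
        = (-1) ^ M * (LINT y:{A<..<B}|lebesgue. v y * \<rho> u y)"
      using h by (simp add: has_weak_deriv_def)
    then have "(LINT y:{A<..<B}|lebesgue. h y * D M u y)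
        = (-1) ^ M * (LINT y:{A<..<B}|lebesgue. v y * \<rho> u y)"
      by (simp only: D)
    moreover have "(LINT y:{A<..<B}|lebesgue. h y * D M u y) = (-1) ^ M * F M u"
    proof -
      have "(-1) ^ M * F M u = ((-1) ^ M * (-1) ^ M) * integral {A..B} (\<lambda>y. h y * D M u y)"
        unfolding F_def integral_mult_right by (simp only: mult.assoc)
      also have "(-1) ^ M * (-1) ^ M = (1::real)" by (simp flip: power_add)
      finally show ?thesis
        by (subst set_integral_open_eq_integral) (intro continuous_intros contD hc, simp)
    qed
    ultimately have "\<bar>F M u\<bar> = \<bar>LINT y:{A<..<B}|lebesgue. v y * \<rho> u y\<bar>"
      by (simp add: abs_mult)
    also have "\<dots> \<le> K * m"
    proof (cases "set_integrable lebesgue {A<..<B} (\<lambda>y. v y * \<rho> u y)")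
      case True
      have ic: "set_integrable lebesgue {A<..<B} (\<lambda>y. K * \<rho> u y)"
        by (rule set_integrable_subset[OF absolutely_integrable_continuous_real[of A B]])
           (auto intro!: continuous_intros \<rho>_cont)
      have "\<bar>LINT y:{A<..<B}|lebesgue. v y * \<rho> u y\<bar> \<le> (LINT y:{A<..<B}|lebesgue. K * \<rho> u y)"
        unfolding set_lebesgue_integral_def real_norm_def[symmetric]
        by (rule Bochner_Integration.integral_norm_bound_integral[OF True[unfolded set_integrable_def] ic[unfolded set_integrable_def]])
           (auto simp: indicator_def abs_mult \<rho>_nonneg intro!: mult_right_mono v)
      also have "\<dots> = K * m"
        by (subst set_integral_open_eq_integral) (use u in \<open>auto intro!: continuous_intros \<rho>_cont simp: \<rho>_int\<close>)
      finally show ?thesis .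
    next
      \<comment> \<open>A non-integrable product has integral 0 by convention, and
        \<open>K * m\<close> is nonnegative.\<close>
      case False
      then show ?thesis using K m
        by (simp add: set_lebesgue_integral_def set_integrable_def not_integrable_integral_eq)
    qed
    finally show ?thesis .
  qed
  have "\<bar>(fdiff \<delta> ^^ M) (F 0) x\<bar> \<le> (K * m) * \<delta> ^ M"
  proof (rule fdiff_pow_le_derivs)
    show "(F i has_real_derivative F (Suc i) y) (at y within {x..x + real M * \<delta>})" for i y
      by (rule has_field_derivative_at_within[OF F])
    show "\<bar>F M y\<bar> \<le> K * m" if "y \<in> {x..x + real M * \<delta>}" for y
      by (rule FM) (use that \<epsilon> in auto)
  qed (use \<delta> in auto)
  moreover have "\<bar>(fdiff \<delta> ^^ M) (\<lambda>u. F 0 u - m * h u) x\<bar> \<le> 2 ^ M * (\<kappa> * m)"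
  proof (rule fdiff_pow_abs_le)
    fix i assume "i \<le> M"
    define u where "u = x + of_nat i * \<delta>"
    have "real i * \<delta> \<le> real M * \<delta>" "0 \<le> real i * \<delta>" using \<open>i \<le> M\<close> \<delta> by (auto intro: mult_right_mono)
    then have u: "A + \<epsilon> < u" "u < B - \<epsilon>" using \<epsilon> by (auto simp: u_def)
    have "F 0 u = integral {A..B} (\<lambda>y. h y * \<rho> u y)"
      using D[of 0 u] by (simp add: F_def)
    then have "F 0 u - m * h u
        = integral {A..B} (\<lambda>y. h y * \<rho> u y) - integral {A..B} (\<lambda>y. h u * \<rho> u y)"
      using u by (simp add: \<rho>_int)
    also have "\<dots> = integral {A..B} (\<lambda>y. (h y - h u) * \<rho> u y)"
      by (subst integral_diff[symmetric])
         (intro integrable_continuous_real continuous_intros \<rho>_cont hc, intro integrable_continuous_real continuous_intros \<rho>_cont hc, simp add: algebra_simps)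
    also have "\<bar>\<dots>\<bar> \<le> integral {A..B} (\<lambda>y. \<kappa> * \<rho> u y)"
      unfolding real_norm_def[symmetric]
    proof (rule Henstock_Kurzweil_Integration.integral_norm_bound_integral)
      fix y assume y: "y \<in> {A..B}"
      show "norm ((h y - h u) * \<rho> u y) \<le> \<kappa> * \<rho> u y"
      proof (cases "\<bar>y - u\<bar> > \<epsilon>")
        case False
        then have "\<bar>h y - h u\<bar> < \<kappa>" by (intro d(2)) (use y u \<epsilon> in auto)
        then show ?thesis using \<rho>_nonneg by (auto simp: abs_mult intro!: mult_right_mono)
      qed (simp add: \<rho>_zero)
    qed (intro integrable_continuous_real continuous_intros \<rho>_cont hc)+
    also have "\<dots> = \<kappa> * m" using u by (simp add: \<rho>_int)
    finally show "\<bar>F 0 (x + of_nat i * \<delta>) - m * h (x + of_nat i * \<delta>)\<bar> \<le> \<kappa> * m" by (simp add: u_def)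
  qed
  ultimately have "\<bar>m * (fdiff \<delta> ^^ M) h x\<bar> \<le> (K * m) * \<delta> ^ M + 2 ^ M * (\<kappa> * m)"
    unfolding fdiff_pow_linear by linarith
  also have "\<dots> = m * (K * \<delta> ^ M + \<kappa>')" by (simp add: \<kappa>_def algebra_simps)
  finally have "m * \<bar>(fdiff \<delta> ^^ M) h x\<bar> \<le> m * (K * \<delta> ^ M + \<kappa>')" using m by (simp add: abs_mult)
  then show "\<bar>(fdiff \<delta> ^^ M) h x\<bar> \<le> K * \<delta> ^ M + \<kappa>'" using m by simp
qed

section \<open>The weighted window\<close>

lemma fdiff_pow_eq_last:
  fixes f :: "'a::semiring_1 \<Rightarrow> real"
  assumes "\<And>i. i < k \<Longrightarrow> f (x + of_nat i * s) = 0"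
  shows "(fdiff s ^^ k) f x = f (x + of_nat k * s)"
  using assms
proof (induction k arbitrary: f)
  case (Suc k)
  have "(fdiff s ^^ k) (fdiff s f) x = fdiff s f (x + of_nat k * s)"
  proof (rule Suc.IH)
    fix i assume "i < k"
    then show "fdiff s f (x + of_nat i * s) = 0"
      using Suc.prems[of i] Suc.prems[of "Suc i"] by (simp add: fdiff_def algebra_simps)
  qed
  also have "\<dots> = f (x + of_nat (Suc k) * s)"
    using Suc.prems[of k] by (simp add: fdiff_def algebra_simps)
  finally show ?case by (simp only: fdiff_pow_Suc)
qed simp

lemma fdiff_pow_abs_eq_first:
  fixes f :: "'a::semiring_1 \<Rightarrow> real"
  assumes "\<And>i. 1 \<le> i \<Longrightarrow> i \<le> k \<Longrightarrow> f (x + of_nat i * s) = 0"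
  shows "\<bar>(fdiff s ^^ k) f x\<bar> = \<bar>f x\<bar>"
  using assms
proof (induction k arbitrary: f)
  case (Suc k)
  have "\<bar>(fdiff s ^^ k) (fdiff s f) x\<bar> = \<bar>fdiff s f x\<bar>"
  proof (rule Suc.IH)
    fix i :: nat assume "1 \<le> i" "i \<le> k"
    then show "fdiff s f (x + of_nat i * s) = 0"
      using Suc.prems[of i] Suc.prems[of "Suc i"] by (simp add: fdiff_def algebra_simps)
  qed
  also have "\<dots> = \<bar>f x\<bar>" using Suc.prems[of 1] by (simp add: fdiff_def)
  finally show ?case by (simp only: fdiff_pow_Suc)
qed simp

lemma bounded_derivs_fdiff_bound:
  fixes F :: "nat \<Rightarrow> real \<Rightarrow> real"
  assumes "\<And>k x. x \<in> {A..B} \<Longrightarrow> (F k has_real_derivative F (Suc k) x) (at x)"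
  obtains K where "0 \<le> K" "\<And>k \<delta> x. k \<le> M \<Longrightarrow> 0 \<le> \<delta> \<Longrightarrow> A \<le> x \<Longrightarrow> x + real k * \<delta> \<le> B \<Longrightarrow>
    \<bar>(fdiff \<delta> ^^ k) (F 0) x\<bar> \<le> K * \<delta> ^ k"
proof -
  have "\<exists>b\<ge>0. \<forall>x\<in>{A..B}. \<bar>F k x\<bar> \<le> b" for k
  proof -
    have "continuous_on {A..B} (F k)"
      using assms by (meson DERIV_isCont continuous_at_imp_continuous_on)
    then have "bounded (F k ` {A..B})"
      by (intro compact_imp_bounded compact_continuous_image) auto
    then obtain b where "b > 0" "\<forall>y\<in>F k ` {A..B}. norm y \<le> b" unfolding bounded_pos by blast
    then show ?thesis by (intro exI[of _ b]) auto
  qed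
  then obtain b where b: "\<And>k. 0 \<le> b k" "\<And>k x. x \<in> {A..B} \<Longrightarrow> \<bar>F k x\<bar> \<le> b k" by metis
  show ?thesis
  proof
    show "0 \<le> (\<Sum>k\<le>M. b k)" using b by (simp add: sum_nonneg)
    fix k x and \<delta> :: real assume *: "k \<le> M" "0 \<le> \<delta>" "A \<le> x" "x + real k * \<delta> \<le> B"
    have "b k \<le> (\<Sum>k\<le>M. b k)" using * b by (intro member_le_sum) auto
    show "\<bar>(fdiff \<delta> ^^ k) (F 0) x\<bar> \<le> (\<Sum>k\<le>M. b k) * \<delta> ^ k"
    proof (rule fdiff_pow_le_derivs[where A = A and B = B])
      show "(F i has_real_derivative F (Suc i) y) (at y within {A..B})" if "y \<in> {A..B}" for i y
        by (rule has_field_derivative_at_within[OF assms[OF that]])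
      show "\<bar>F k y\<bar> \<le> (\<Sum>k\<le>M. b k)" if "y \<in> {A..B}" for y
        using b(2)[OF that, of k] \<open>b k \<le> _\<close> by linarith
    qed (use * in auto)
  qed
qed

lemma smooth_fdiff_bound:
  assumes "smooth f"
  obtains K where "0 \<le> K" "\<And>k \<delta> x. k \<le> M \<Longrightarrow> 0 \<le> \<delta> \<Longrightarrow> A \<le> x \<Longrightarrow> x + real k * \<delta> \<le> B \<Longrightarrow>
    \<bar>(fdiff \<delta> ^^ k) f x\<bar> \<le> K * \<delta> ^ k"
  by (rule bounded_derivs_fdiff_bound[of A B "\<lambda>k. (deriv ^^ k) f" M])
     (use smooth_has_deriv[OF assms] in auto)

lemma powr_fdiff_bound:
  obtains K where "0 \<le> K" "\<And>k \<delta> x. k \<le> M \<Longrightarrow> 0 \<le> \<delta> \<Longrightarrow> 1/2 \<le> x \<Longrightarrow> x + real k * \<delta> \<le> 2 \<Longrightarrow>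
    \<bar>(fdiff \<delta> ^^ k) (\<lambda>x. x powr p) x\<bar> \<le> K * \<delta> ^ k"
proof -
  define F where "F k x = (\<Prod>i<k. p - real i) * x powr (p - real k)" for k x
  have "(F k has_real_derivative F (Suc k) x) (at x)" if "x \<in> {1/2..2}" for k x
    using that unfolding F_def
    by (auto intro!: derivative_eq_intros simp: algebra_simps)
  then obtain K where "0 \<le> K" "\<And>k \<delta> x. k \<le> M \<Longrightarrow> 0 \<le> \<delta> \<Longrightarrow> 1/2 \<le> x \<Longrightarrow> x + real k * \<delta> \<le> 2 \<Longrightarrow>
    \<bar>(fdiff \<delta> ^^ k) (F 0) x\<bar> \<le> K * \<delta> ^ k"
    using bounded_derivs_fdiff_bound[of "1/2" 2 F M] by metis
  moreover have "F 0 = (\<lambda>x. x powr p)" by (simp add: F_def fun_eq_iff)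
  ultimately show ?thesis using that by auto
qed

lemma continuous_zero_left:
  fixes f :: "real \<Rightarrow> real"
  assumes "continuous_on UNIV f" "\<And>x. x < p \<Longrightarrow> f x = 0"
  shows "f p = 0"
proof (rule continuous_constant_on_closure[of "{..<p}" f 0 p])
  show "continuous_on (closure {..<p}) f" using assms(1) by (rule continuous_on_subset) auto
qed (use assms in auto)

lemma continuous_zero_right:
  fixes f :: "real \<Rightarrow> real"
  assumes "continuous_on UNIV f" "\<And>x. x > p \<Longrightarrow> f x = 0"
  shows "f p = 0"
proof (rule continuous_constant_on_closure[of "{p<..}" f 0 p])
  show "continuous_on (closure {p<..}) f" using assms(1) by (rule continuous_on_subset) auto
qed (use assms in auto)

text \<open>The definition of the window leaves the values of \<open>a\<close> at the endpoints 1/2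
  and 2, and of \<phi> at 1 and -1, open; continuity forces them to be 0.\<close>

lemma
  assumes "wavelet_window \<phi> a"
  shows wavelet_window_zero: "\<not> (1/2 < \<bar>\<xi>\<bar> \<and> \<bar>\<xi>\<bar> < 2) \<Longrightarrow> a \<xi> = 0"
    and wavelet_window_bump_zero: "\<bar>\<xi>\<bar> \<ge> 1 \<Longrightarrow> \<phi> \<xi> = 0"
proof -
  have smooth: "smooth a" "smooth \<phi>" and even: "\<And>\<xi>. a (- \<xi>) = a \<xi>"
    and z: "\<And>\<xi>. \<not> (1/2 \<le> \<bar>\<xi>\<bar> \<and> \<bar>\<xi>\<bar> \<le> 2) \<Longrightarrow> a \<xi> = 0" "\<And>\<xi>. \<bar>\<xi>\<bar> > 1 \<Longrightarrow> \<phi> \<xi> = 0"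
    using assms unfolding wavelet_window_def by blast+
  have cont: "continuous_on UNIV a" "continuous_on UNIV \<phi>"
    using smooth_continuous_on[OF smooth(1), where n = 0] smooth_continuous_on[OF smooth(2), where n = 0] by auto
  have two: "a 2 = 0" by (rule continuous_zero_right[OF cont(1)]) (use z in auto)
  have half: "a (1/2) = 0"
  proof (rule continuous_constant_on_closure[of "{0<..<1/2}" a 0 "1/2"])
    show "continuous_on (closure {0<..<1/2}) a" using cont(1) by (rule continuous_on_subset) auto
  qed (use z in auto)
  have a0: "a x = 0" if x: "0 \<le> x" "x \<le> 1/2 \<or> 2 \<le> x" for x
  proof -
    consider "x = 1/2" | "x = 2" | "x < 1/2" | "2 < x" using x(2) by linarith
    then show ?thesis
    proof cases
      case 1
      show ?thesis unfolding 1 by (fact half)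
    qed (use z(1)[of x] two x(1) in auto)
  qed
  show "a \<xi> = 0" if "\<not> (1/2 < \<bar>\<xi>\<bar> \<and> \<bar>\<xi>\<bar> < 2)"
  proof (cases "\<xi> \<ge> 0")
    case True
    then show ?thesis using that by (intro a0) auto
  next
    case False
    then have "a (- \<xi>) = 0" using that by (intro a0) auto
    then show ?thesis by (simp add: even)
  qed
  have "\<phi> 1 = 0" by (rule continuous_zero_right[OF cont(2)]) (use z in auto)
  moreover have "\<phi> (-1) = 0" by (rule continuous_zero_left[OF cont(2)]) (use z in auto)
  ultimately show "\<bar>\<xi>\<bar> \<ge> 1 \<Longrightarrow> \<phi> \<xi> = 0"
    using z(2)[of \<xi>] by (cases "\<bar>\<xi>\<bar> = 1") (auto simp: abs_if split: if_splits)
qed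

text \<open>The two differences telescope to \<phi>(x/2) - \<phi>(2x), and on [1/2, 1] the first
  argument lies on the plateau of \<phi> and the second beyond its support.\<close>

lemma wavelet_window_sq_add:
  assumes "wavelet_window \<phi> a" "1/2 \<le> x" "x \<le> 1"
  shows "(a x)\<^sup>2 + (a (2 * x))\<^sup>2 = 1"
proof -
  have "(a \<xi>)\<^sup>2 = \<phi> (\<xi> / 2) - \<phi> \<xi>" for \<xi> using assms(1) unfolding wavelet_window_def by blast
  moreover have "\<phi> (x / 2) = 1" using assms unfolding wavelet_window_def by auto
  moreover have "\<phi> (2 * x) = 0" using wavelet_window_bump_zero[OF assms(1)] assms by auto
  ultimately show ?thesis by simp
qed

text \<open>Pair each index \<open>l\<close> in \<open>{m..2*m}\<close> with \<open>2 * l\<close>: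
  every pair contributes 1, and either family of indices is part of the full sum, so twice that sum
  is at least \<open>m\<close>.\<close>

lemma sum_window_sq_ge:
  assumes a: "wavelet_window \<phi> a" and m: "0 < m"
  shows "real m / 2 \<le> (\<Sum>l<8*m. (a (real l / (2 * real m)))\<^sup>2)"
proof -
  define q where "q l = (a (real l / (2 * real m)))\<^sup>2" for l
  have q: "0 \<le> q l" for l by (simp add: q_def)
  have "real m \<le> (\<Sum>l\<in>{m..2*m}. 1)" by simp
  also have "\<dots> = (\<Sum>l\<in>{m..2*m}. q l + q (2 * l))"
  proof (rule sum.cong)
    fix l assume "l \<in> {m..2*m}"
    then have "1/2 \<le> real l / (2 * real m)" "real l / (2 * real m) \<le> 1"
      using m by (auto simp: field_simps)
    from wavelet_window_sq_add[OF a this] show "1 = q l + q (2 * l)"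
      by (simp add: q_def)
  qed simp
  also have "\<dots> = (\<Sum>l\<in>{m..2*m}. q l) + (\<Sum>l\<in>{m..2*m}. q (2 * l))" by (rule sum.distrib)
  also have "(\<Sum>l\<in>{m..2*m}. q (2 * l)) = (\<Sum>l\<in>(\<lambda>l. 2 * l) ` {m..2*m}. q l)"
    by (subst sum.reindex) (auto simp: inj_on_def)
  also have "(\<Sum>l\<in>{m..2*m}. q l) \<le> (\<Sum>l<8*m. q l)"
    using m q by (intro sum_mono2) auto
  also have "(\<Sum>l\<in>(\<lambda>l. 2 * l) ` {m..2*m}. q l) \<le> (\<Sum>l<8*m. q l)"
    using m q by (intro sum_mono2) auto
  finally show ?thesis by (simp add: q_def)
qed

text \<open>With step \<open>s\<close> equal to the distance of \<open>u\<close> from the edge, a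
  stencil of order \<open>M\<close> can be placed so that \<open>u\<close> is its only point where
  \<open>a\<close> may be nonzero. The difference is then \<open>a u\<close> up to sign, and
  smoothness makes it O(s^M).\<close>

lemma window_vanishing_order:
  assumes a: "wavelet_window \<phi> a"
  obtains K where "0 \<le> K"
    "\<And>u. 1/2 \<le> u \<Longrightarrow> u \<le> 2 \<Longrightarrow> \<bar>a u\<bar> \<le> K * (u - 1/2) ^ M"
    "\<And>u. 1/2 \<le> u \<Longrightarrow> u \<le> 2 \<Longrightarrow> \<bar>a u\<bar> \<le> K * (2 - u) ^ M"
proof -
  have "smooth a" using a unfolding wavelet_window_def by blast
  \<comment> \<open>As \<open>s \<le> 2\<close>, this interval contains every stencil used
    below.\<close>
  then obtain K where K: "0 \<le> K" "\<And>k \<delta> x. k \<le> M \<Longrightarrow> 0 \<le> \<delta> \<Longrightarrow> - 2 * real M \<le> x \<Longrightarrow> x + real k * \<delta>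
      \<le> 2 + 2 * real M \<Longrightarrow>
    \<bar>(fdiff \<delta> ^^ k) a x\<bar> \<le> K * \<delta> ^ k" using smooth_fdiff_bound[of a M "- 2 * real M" "2 + 2 * real M"] by metis
  \<comment> \<open>The summand \<open>M ^ M\<close> covers \<open>M * s \<ge> 1\<close>: at the
    left edge such a stencil may pass -1/2, where the even function \<open>a\<close> is nonzero
    again, but then \<open>a\<close> is bounded by \<open>K \<le> K * (M * s) ^ M\<close>
    anyway.\<close>
  define L where "L = K * (1 + real M ^ M)"
  have "0 \<le> L" using K by (simp add: L_def)
  have le_L: "\<bar>a u\<bar> \<le> L * s ^ M" if u: "1/2 \<le> u" "u \<le> 2" and s: "0 \<le> s"
      and "\<bar>a u\<bar> \<le> K * s ^ M \<or> real M * s \<ge> 1" for u s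
    using that(4)
  proof
    assume "\<bar>a u\<bar> \<le> K * s ^ M"
    also have "\<dots> \<le> L * s ^ M" using K(1) s
      by (intro mult_right_mono) (auto simp: L_def algebra_simps)
    finally show ?thesis .
  next
    assume "real M * s \<ge> 1"
    have "\<bar>a u\<bar> \<le> K * 1" using K(2)[of 0 0 u] u by simp
    also have "\<dots> \<le> K * (real M * s) ^ M" using K(1) \<open>real M * s \<ge> 1\<close>
      by (intro mult_left_mono one_le_power)
    also have "\<dots> = K * real M ^ M * s ^ M" by (simp add: power_mult_distrib)
    also have "\<dots> \<le> L * s ^ M" using K(1) s
      by (intro mult_right_mono) (auto simp: L_def algebra_simps)
    finally show ?thesis .
  qed
  show ?thesis
  proof (rule that[OF \<open>0 \<le> L\<close>])
    fix u :: real assume u: "1/2 \<le> u" "u \<le> 2"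
    define s where "s = u - 1/2"
    have s: "0 \<le> s" "s \<le> 2" using u by (auto simp: s_def)
    have "\<bar>a u\<bar> \<le> K * s ^ M" if "real M * s \<le> 1"
    proof -
      have "(fdiff s ^^ M) a (u - real M * s) = a (u - real M * s + of_nat M * s)"
      proof (rule fdiff_pow_eq_last)
        fix i assume i: "i < M"
        have e: "u - real M * s + real i * s = 1/2 - (real M - real i - 1) * s"
          by (simp add: s_def algebra_simps)
        have "0 \<le> (real M - real i - 1) * s" using i s by simp
        moreover have "(real M - real i - 1) * s \<le> real M * s" using s
          by (intro mult_right_mono) auto
        ultimately have "\<bar>u - real M * s + real i * s\<bar> \<le> 1/2" using that unfolding e by linarith
        then show "a (u - real M * s + of_nat i * s) = 0"
          by (intro wavelet_window_zero[OF a]) linarith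
      qed
      moreover have "\<bar>(fdiff s ^^ M) a (u - real M * s)\<bar> \<le> K * s ^ M"
        using K(2)[of M s "u - real M * s"] s u mult_left_mono[OF s(2), of "real M"] by simp
      ultimately show ?thesis by simp
    qed
    then show "\<bar>a u\<bar> \<le> L * (u - 1/2) ^ M"
      using le_L[OF u s(1)] unfolding s_def by linarith
  next
    fix u :: real assume u: "1/2 \<le> u" "u \<le> 2"
    define s where "s = 2 - u"
    have s: "0 \<le> s" "s \<le> 2" using u by (auto simp: s_def)
    have "\<bar>(fdiff s ^^ M) a u\<bar> = \<bar>a u\<bar>"
    proof (rule fdiff_pow_abs_eq_first)
      fix i :: nat assume i: "1 \<le> i"
      have e: "u + real i * s = 2 + (real i - 1) * s" by (simp add: s_def algebra_simps)
      have "0 \<le> (real i - 1) * s" using i s by simp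
      then show "a (u + of_nat i * s) = 0"
        by (intro wavelet_window_zero[OF a]) (auto simp: e)
    qed
    moreover have "\<bar>(fdiff s ^^ M) a u\<bar> \<le> K * s ^ M"
      using K(2)[of M s u] s u mult_left_mono[OF s(2), of "real M"] by simp
    ultimately show "\<bar>a u\<bar> \<le> L * (2 - u) ^ M"
      using le_L[OF u s(1)] unfolding s_def by simp
  qed
qed

text \<open>The grid step is \<open>1 / (2 * m)\<close>, but interpolation works at scale
  \<open>1 / n\<close>; \<open>n \<le> 4 * m\<close> makes the step at most \<open>2 / n\<close>,
  which costs \<open>2 ^ M\<close>.\<close>

lemma fdiff_bounded_grid:
  fixes F :: "real \<Rightarrow> real"
  assumes "\<And>k \<delta> x. k \<le> M \<Longrightarrow> 0 \<le> \<delta> \<Longrightarrow> 1/2 \<le> x \<Longrightarrow> x + real k * \<delta> \<le> 2 \<Longrightarrow> \<bar>(fdiff \<delta> ^^ k) F x\<bar> \<le> K * \<delta> ^ k"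
    and "0 \<le> K" "0 < m" "0 < n" "n \<le> 4 * m"
  shows "fdiff_bounded (m + 1) (4 * m - 1) (1 / real n) M (2 ^ M * K) (\<lambda>l. F (real l / (2 * real m)))"
  unfolding fdiff_bounded_def
proof (intro allI impI)
  fix i l assume i: "i \<le> M" and l: "m + 1 \<le> l" "l + i \<le> 4 * m - 1"
  define \<delta> where "\<delta> = 1 / (2 * real m)"
  have "real (l + i) \<le> real (4 * m)" using l by (intro of_nat_mono) simp
  then have x: "1/2 \<le> \<delta> * real l" "\<delta> * real l + real i * \<delta> \<le> 2" "0 \<le> \<delta>"
    using l \<open>0 < m\<close> by (auto simp: \<delta>_def field_simps)
  have \<delta>_le: "\<delta> \<le> 2 * (1 / real n)"
    using assms(3-5) by (simp add: \<delta>_def field_simps)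
  have "(\<lambda>l. F (real l / (2 * real m))) = (\<lambda>l. F (\<delta> * real l))" by (simp add: \<delta>_def)
  then have "\<bar>(fdiff 1 ^^ i) (\<lambda>l. F (real l / (2 * real m))) l\<bar> = \<bar>(fdiff \<delta> ^^ i) F (\<delta> * real l)\<bar>"
    using fdiff_pow_grid[of i F \<delta> l] by simp
  also have "\<dots> \<le> K * \<delta> ^ i" using x i by (intro assms(1)) auto
  also have "\<dots> \<le> K * (2 * (1 / real n)) ^ i"
    using assms \<delta>_le x by (intro mult_left_mono power_mono) auto
  also have "\<dots> = 2 ^ i * K * (1 / real n) ^ i" by (simp only: power_mult_distrib mult_ac)
  also have "\<dots> \<le> 2 ^ M * K * (1 / real n) ^ i"
    using assms i by (intro mult_right_mono power_increasing) auto
  finally show "\<bar>(fdiff 1 ^^ i) (\<lambda>l. F (real l / (2 * real m))) l\<bar> \<le> 2 ^ M * K * (1 / real n) ^ i" .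
qed

text \<open>Two regimes. Stencils inside the open window are handled by the Leibniz rule. If a
  stencil meets or crosses an edge, its points inside lie within \<open>M / m\<close> of that edge,
  so one factor \<open>a\<close> is already O(m^-M) and the other factors need only be
  bounded.\<close>

lemma weighted_window_fdiff_le:
  assumes a: "wavelet_window \<phi> a" and M: "0 < M" and H: "0 \<le> H" and B: "0 \<le> B"
  obtains K where "0 \<le> K"
    "\<And>m h v l. M < m \<Longrightarrow> (\<forall>u\<in>{1/2..2}. \<bar>h u\<bar> \<le> H) \<Longrightarrow> has_weak_deriv M {1/2..2} h v \<Longrightarrow>
      (\<forall>u\<in>{1/2..2}. \<bar>v u\<bar> \<le> B) \<Longrightarrow>
      \<bar>(fdiff 1 ^^ M) (\<lambda>l. let u = real l / (2 * real m) in h u * u powr p * (a u)\<^sup>2) l\<bar> \<le> K / real m ^ M"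
proof -
  have \<phi>: "smooth \<phi>" "\<And>\<xi>. 0 \<le> \<phi> \<xi>" "\<And>\<xi>. \<bar>\<xi>\<bar> > 1 \<Longrightarrow> \<phi> \<xi> = 0" "\<phi> 0 \<noteq> 0" and "smooth a"
    using a unfolding wavelet_window_def by auto
  obtain Kr where Kr: "0 \<le> Kr" "\<And>k \<delta> x. k \<le> M \<Longrightarrow> 0 \<le> \<delta> \<Longrightarrow> 1/2 \<le> x \<Longrightarrow> x + real k * \<delta> \<le> 2 \<Longrightarrow>
    \<bar>(fdiff \<delta> ^^ k) (\<lambda>x. x powr p) x\<bar> \<le> Kr * \<delta> ^ k" using powr_fdiff_bound[of M p] by metis
  obtain Ka where Ka: "0 \<le> Ka" "\<And>k \<delta> x. k \<le> M \<Longrightarrow> 0 \<le> \<delta> \<Longrightarrow> 1/2 \<le> x \<Longrightarrow> x + real k * \<delta> \<le> 2 \<Longrightarrow>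
    \<bar>(fdiff \<delta> ^^ k) a x\<bar> \<le> Ka * \<delta> ^ k" using smooth_fdiff_bound[OF \<open>smooth a\<close>, of M "1/2" 2] by metis
  obtain Kv where Kv: "0 \<le> Kv"
    "\<And>u. 1/2 \<le> u \<Longrightarrow> u \<le> 2 \<Longrightarrow> \<bar>a u\<bar> \<le> Kv * (u - 1/2) ^ M"
    "\<And>u. 1/2 \<le> u \<Longrightarrow> u \<le> 2 \<Longrightarrow> \<bar>a u\<bar> \<le> Kv * (2 - u) ^ M"
    using window_vanishing_order[OF a, of M] by metis
  obtain Kh where Kh: "0 \<le> Kh"
    "\<And>f lo n. M \<le> n \<Longrightarrow> (\<And>l. lo \<le> l \<Longrightarrow> l \<le> lo + n \<Longrightarrow> \<bar>f l\<bar> \<le> H) \<Longrightarrow>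
       (\<And>l. lo \<le> l \<Longrightarrow> l + M \<le> lo + n \<Longrightarrow> \<bar>(fdiff 1 ^^ M) f l\<bar> \<le> (2 ^ M * B) / real n ^ M) \<Longrightarrow>
       fdiff_bounded lo (lo + n) (1 / real n) M Kh f"
    using fdiff_pow_intermediate[of H "2 ^ M * B" M] H B by auto
  \<comment> \<open>Three applications of the Leibniz rule, to \<open>h\<close> times the power, to
    \<open>a\<close> times \<open>a\<close>, and to the two results; the inner \<open>2 ^ M\<close>
    on \<open>Kr\<close> and \<open>Ka\<close> come from \<open>fdiff_bounded_grid\<close>.\<close>
  define L where "L = 2 ^ M * (2 ^ M * Kh * (2 ^ M * Kr)) * (2 ^ M * (2 ^ M * Ka) * (2 ^ M * Ka))"
  define E where "E = 2 ^ M * (H * Kr * (Ka * Kv) * real M ^ M)"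
  have LE: "0 \<le> L" "0 \<le> E" using Kr Ka Kv Kh H by (auto simp: L_def E_def)
  show ?thesis
  proof (rule that[of "L + E"])
    fix m h v l
    assume m: "M < m" and "\<forall>u\<in>{1/2..2}. \<bar>h u\<bar> \<le> H" and hv: "has_weak_deriv M {1/2..2} h v"
      and "\<forall>u\<in>{1/2..2}. \<bar>v u\<bar> \<le> B"
    then have h: "\<And>u. u \<in> {1/2..2} \<Longrightarrow> \<bar>h u\<bar> \<le> H" and v: "\<And>u. u \<in> {1/2..2} \<Longrightarrow> \<bar>v u\<bar> \<le> B" by auto
    define \<delta> where "\<delta> = 1 / (2 * real m)"
    \<comment> \<open>The length of \<open>{m + 1..4 * m - 1}\<close>, the grid points strictly
      inside (1/2, 2). The endpoints are left out because \<open>weak_deriv_fdiff_le\<close> needs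
      stencils in the open interval.\<close>
    define n where "n = 3 * m - 2"
    have n: "M \<le> n" "0 < n" "n \<le> 4 * m" "m \<le> n" and mn: "(m + 1) + n = 4 * m - 1" using m
      by (auto simp: n_def)
    have m0: "0 < m" using m by simp
    define f where "f l = (let u = real l / (2 * real m) in h u * u powr p * (a u)\<^sup>2)" for l :: nat
    have in_range: "real l / (2 * real m) \<in> {1/2<..<2}" if "m + 1 \<le> l" "l \<le> 4 * m - 1" for l
      using that m0 by (auto simp: field_simps)
    have "\<bar>(fdiff 1 ^^ M) f l\<bar> \<le> (L + E) / real m ^ M"
    proof (cases "m + 1 \<le> l \<and> l + M \<le> 4 * m - 1")
      case True
      have "fdiff_bounded (m + 1) (4 * m - 1) (1 / real n) M Kh (\<lambda>l. h (real l / (2 * real m)))"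
        unfolding mn[symmetric]
      proof (rule Kh(2)[OF n(1)])
        fix l assume "m + 1 \<le> l" "l \<le> m + 1 + n"
        then show "\<bar>h (real l / (2 * real m))\<bar> \<le> H"
          using in_range[of l] mn by (intro h) auto
      next
        fix l assume l: "m + 1 \<le> l" "l + M \<le> m + 1 + n"
        have eq: "(\<lambda>l. h (real l / (2 * real m))) = (\<lambda>l. h (\<delta> * real l))" by (simp add: \<delta>_def)
        have "\<bar>(fdiff 1 ^^ M) (\<lambda>l. h (real l / (2 * real m))) l\<bar> = \<bar>(fdiff \<delta> ^^ M) h (\<delta> * real l)\<bar>"
          unfolding eq by (simp only: fdiff_pow_grid)
        also have "\<dots> \<le> B * \<delta> ^ M"
        proof (rule weak_deriv_fdiff_le[OF hv M v \<phi>])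
          show "1/2 < \<delta> * real l" using in_range[of l] l mn by (auto simp: \<delta>_def)
          have "\<delta> * real l + real M * \<delta> = real (l + M) / (2 * real m)"
            by (simp add: \<delta>_def add_divide_distrib)
          then show "\<delta> * real l + real M * \<delta> < 2" using in_range[of "l + M"] l mn by auto
        qed (auto simp: \<delta>_def)
        also have "\<dots> \<le> B * (2 * (1 / real n)) ^ M"
          using B n m0 by (intro mult_left_mono power_mono) (auto simp: \<delta>_def field_simps)
        also have "\<dots> = (2 ^ M * B) / real n ^ M"
          by (simp add: power_mult_distrib power_one_over field_simps)
        finally show "\<bar>(fdiff 1 ^^ M) (\<lambda>l. h (real l / (2 * real m))) l\<bar>
            \<le> (2 ^ M * B) / real n ^ M" .
      qed
      note bh = this
      note br = fdiff_bounded_grid[of M "\<lambda>x. x powr p" Kr, OF Kr(2) Kr(1) m0 n(2,3)]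
      note ba = fdiff_bounded_grid[of M a Ka, OF Ka(2) Ka(1) m0 n(2,3)]
      have "fdiff_bounded (m + 1) (4 * m - 1) (1 / real n) M L
        (\<lambda>l. h (real l / (2 * real m)) * (real l / (2 * real m)) powr p * (a (real l / (2 * real m)) * a (real l / (2 * real m))))"
        unfolding L_def
        by (intro fdiff_bounded_mult bh br ba) (use Kh Kr Ka in auto)
      then have "\<bar>(fdiff 1 ^^ M) f l\<bar> \<le> L * (1 / real n) ^ M"
        using True unfolding fdiff_bounded_def f_def[abs_def] Let_def power2_eq_square by blast
      also have "\<dots> \<le> L * (1 / real m) ^ M"
        using LE n m0 by (intro mult_left_mono power_mono) (auto simp: field_simps)
      also have "\<dots> \<le> (L + E) / real m ^ M" using LE m0
        by (simp add: power_one_over divide_right_mono)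
      finally show ?thesis .
    next
      case False
      have "\<bar>f (l + i)\<bar> \<le> H * Kr * (Ka * (Kv * (real M / real m) ^ M))" if i: "i \<le> M" for i
      proof (cases "m + 1 \<le> l + i \<and> l + i \<le> 4 * m - 1")
        case False
        then have "a (real (l + i) / (2 * real m)) = 0"
          using m0 by (intro wavelet_window_zero[OF a]) (auto simp: field_simps)
        then show ?thesis using H Kr Ka Kv by (simp add: f_def Let_def del: of_nat_add)
      next
        case in': True
        define u where "u = real (l + i) / (2 * real m)"
        have u: "1/2 \<le> u" "u \<le> 2" using in_range[of "l + i"] in' by (auto simp: u_def)
        have au: "\<bar>a u\<bar> \<le> Kv * (real M / real m) ^ M"
        proof (cases "m + 1 \<le> l")
          case True
          then have "4 * m \<le> l + i + M" using False i by linarith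
          then have "real (4 * m) \<le> real (l + i + M)" by (rule of_nat_mono)
          then have "(real (4 * m) - real (l + i)) / (2 * real m) \<le> (2 * real M) / (2 * real m)"
            by (intro divide_right_mono) auto
          then have "2 - u \<le> real M / real m" using m0 by (simp add: u_def diff_divide_distrib)
          then have "Kv * (2 - u) ^ M \<le> Kv * (real M / real m) ^ M"
            using u Kv(1) by (intro mult_left_mono power_mono) auto
          then show ?thesis using Kv(3)[OF u] by linarith
        next
          case False
          then have "l + i \<le> m + M" using i by linarith
          then have "real (l + i) \<le> real (m + M)" by (rule of_nat_mono)
          then have "(real (l + i) - real m) / (2 * real m) \<le> (2 * real M) / (2 * real m)"
            by (intro divide_right_mono) auto
          then have "u - 1/2 \<le> real M / real m" using m0 by (simp add: u_def diff_divide_distrib)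
          then have "Kv * (u - 1/2) ^ M \<le> Kv * (real M / real m) ^ M"
            using u Kv(1) by (intro mult_left_mono power_mono) auto
          then show ?thesis using Kv(2)[OF u] by linarith
        qed
        have au': "\<bar>a u\<bar> \<le> Ka" and ur: "\<bar>u powr p\<bar> \<le> Kr" using Ka(2)[of 0 0 u] Kr(2)[of 0 0 u] u
          by auto
        have "\<bar>f (l + i)\<bar> = \<bar>h u\<bar> * \<bar>u powr p\<bar> * (\<bar>a u\<bar> * \<bar>a u\<bar>)"
          by (simp add: f_def Let_def u_def[symmetric] abs_mult power2_eq_square del: of_nat_add)
        also have "\<dots> \<le> H * Kr * (Ka * (Kv * (real M / real m) ^ M))"
          using h[of u] u au au' ur H Kr Ka Kv by (intro mult_mono) auto
        finally show ?thesis .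
      qed
      then have "\<bar>(fdiff 1 ^^ M) f l\<bar> \<le> 2 ^ M * (H * Kr * (Ka * (Kv * (real M / real m) ^ M)))"
        by (intro fdiff_pow_abs_le) simp
      also have "\<dots> = E / real m ^ M" by (simp add: E_def power_divide)
      also have "\<dots> \<le> (L + E) / real m ^ M" using LE by (intro divide_right_mono) auto
      finally show ?thesis .
    qed
    then show "\<bar>(fdiff 1 ^^ M) (\<lambda>l. let u = real l / (2 * real m) in h u * u powr p * (a u)\<^sup>2) l\<bar>
        \<le> (L + E) / real m ^ M"
      unfolding f_def[abs_def] .
  qed (use LE in simp)
qed

section \<open>The phase and the centred residue\<close>

lemma cmod_one_minus_cis: "cmod (1 - cis \<theta>) = 2 * \<bar>sin (\<theta> / 2)\<bar>"
proof -
  have "(cmod (1 - cis \<theta>))\<^sup>2 = (1 - cos \<theta>)\<^sup>2 + (sin \<theta>)\<^sup>2" by (simp add: cmod_power2)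
  also have "\<dots> = 2 - 2 * cos \<theta>"
    using sin_cos_squared_add[of \<theta>] by (simp add: power2_eq_square algebra_simps)
  also have "\<dots> = (2 * \<bar>sin (\<theta> / 2)\<bar>)\<^sup>2"
    using cos_double_sin[of "\<theta> / 2"] by (simp add: power_mult_distrib)
  finally show ?thesis by (rule power2_eq_imp_eq) auto
qed

text \<open>Jordan's inequality: by concavity the sine lies above its chord from 0 to pi/2.\<close>

lemma sin_ge_chord:
  assumes "0 \<le> y" "y \<le> pi / 2"
  shows "2 * y / pi \<le> sin y"
proof -
  have "convex_on {0..pi} (\<lambda>x. - sin x)"
    by (rule f''_ge0_imp_convex[where f' = "\<lambda>x. - cos x" and f'' = sin])
       (auto intro!: derivative_eq_intros sin_ge_zero)
  from convex_onD[OF this, of "2 * y / pi" 0 "pi / 2"] assms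
  show ?thesis by (simp add: field_simps)
qed

text \<open>The phase is \<open>2 * b\<close>-periodic in \<open>d\<close>, so \<open>d\<close> may
  be replaced by its representative in [-b, b). Half the resulting angle is at most pi/2 in modulus,
  where Jordan's inequality applies.\<close>

lemma cmod_one_minus_cis_ge:
  assumes "0 < b"
  shows "2 * real_of_int (centred_residue b d) / real_of_int b
    \<le> cmod (1 - cis (2 * pi / real_of_int (2 * b) * real_of_int d))"
proof -
  define \<rho> where "\<rho> = (d + b) mod (2 * b) - b"
  have "0 \<le> (d + b) mod (2 * b)" "(d + b) mod (2 * b) < 2 * b" using assms by auto
  then have \<rho>: "\<bar>\<rho>\<bar> \<le> b" unfolding \<rho>_def by linarith
  have d: "d = \<rho> + (2 * b) * ((d + b) div (2 * b))"
    using div_mult_mod_eq[of "d + b" "2 * b"] by (simp add: \<rho>_def algebra_simps)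
  define t where "t = (d + b) div (2 * b)"
  have "real_of_int d = real_of_int \<rho> + real_of_int (2 * b) * real_of_int t"
    using d unfolding t_def[symmetric] by (metis of_int_add of_int_mult)
  then have "2 * pi / real_of_int (2 * b) * real_of_int d
      = 2 * pi / real_of_int (2 * b) * real_of_int \<rho> + 2 * pi * real_of_int t"
    using assms by (simp add: field_simps)
  then have "cis (2 * pi / real_of_int (2 * b) * real_of_int d)
      = cis (2 * pi / real_of_int (2 * b) * real_of_int \<rho>)"
    by (simp add: cis_mult[symmetric] cis_multiple_2pi)
  then have "cmod (1 - cis (2 * pi / real_of_int (2 * b) * real_of_int d))
      = 2 * \<bar>sin (pi * real_of_int \<rho> / (2 * real_of_int b))\<bar>"
    by (simp add: cmod_one_minus_cis mult_ac)
  also have "\<bar>sin (pi * real_of_int \<rho> / (2 * real_of_int b))\<bar>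
      = \<bar>sin (pi * real_of_int \<bar>\<rho>\<bar> / (2 * real_of_int b))\<bar>"
    by (cases "\<rho> \<ge> 0") auto
  also have "2 * \<bar>sin (pi * real_of_int \<bar>\<rho>\<bar> / (2 * real_of_int b))\<bar> \<ge> 2 * (real_of_int \<bar>\<rho>\<bar> / real_of_int b)"
  proof -
    have "real_of_int \<bar>\<rho>\<bar> \<le> real_of_int b" using \<rho> by (simp only: of_int_le_iff)
    then have "2 * (pi * real_of_int \<bar>\<rho>\<bar> / (2 * real_of_int b)) / pi
        \<le> sin (pi * real_of_int \<bar>\<rho>\<bar> / (2 * real_of_int b))"
      using assms by (intro sin_ge_chord) (auto simp: field_simps)
    moreover have "2 * (pi * real_of_int \<bar>\<rho>\<bar> / (2 * real_of_int b)) / pi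
        = real_of_int \<bar>\<rho>\<bar> / real_of_int b"
      using assms by simp
    ultimately show ?thesis by linarith
  qed
  finally show ?thesis by (simp add: centred_residue_def \<rho>_def)
qed

section \<open>Covariances of the wavelet coefficients\<close>

lemma integral_cis:
  "(LINT t:{-pi..pi}|lborel. cis (of_int m * t)) = (if m = 0 then complex_of_real (2 * pi) else 0)"
proof -
  have c: "continuous_on {-pi..pi} (\<lambda>t. cis (of_int m * t))" by (intro continuous_intros)
  have "(LINT t:{-pi..pi}|lborel. cis (of_int m * t)) = integral {-pi..pi} (\<lambda>t. cis (of_int m * t))"
    by (rule set_borel_integral_eq_integral(2)[OF borel_integrable_atLeastAtMost'[OF c]])
  also have "\<dots> = (if m = 0 then complex_of_real (2 * pi) else 0)"
  proof (cases "m = 0")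
    case True
    then show ?thesis by (simp add: scaleR_conv_of_real)
  next
    case False
    have "((\<lambda>t. cis (of_int m * t) / (\<i> * of_int m)) has_vector_derivative cis (of_int m * t)) (at t within {-pi..pi})" for t :: real
    proof -
      have "((\<lambda>t. cis (of_int m * t)) has_vector_derivative \<i> * of_int m * cis (of_int m * t)) (at t within {-pi..pi})"
        unfolding has_vector_derivative_def
        by (rule has_derivative_eq_rhs, rule has_derivative_cis)
           (auto intro!: derivative_eq_intros simp: scaleR_conv_of_real mult_ac fun_eq_iff)
      from has_vector_derivative_divide[OF this, of "\<i> * of_int m"] False show ?thesis by simp
    qed
    then have "((\<lambda>t. cis (of_int m * t)) has_integral
        (cis (of_int m * pi) / (\<i> * of_int m) - cis (of_int m * (-pi)) / (\<i> * of_int m))) {-pi..pi}"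
      by (intro fundamental_theorem_of_calculus) auto
    moreover have "cis (of_int m * pi) = cis (of_int m * (-pi))"
    proof -
      have "cis (of_int m * pi) = cis (of_int m * (-pi)) * cis (2 * pi * of_int m)"
        by (simp add: cis_mult algebra_simps)
      then show ?thesis by (simp add: cis_multiple_2pi)
    qed
    ultimately show ?thesis using False by (auto intro: integral_unique)
  qed
  finally show ?thesis .
qed

section \<open>Second moments of the random weights\<close>

context torus_field
begin

lemma w_measurable' [measurable]: "w l \<in> borel_measurable P"
  by (rule w_measurable)

lemma X_measurable' [measurable]: "case_prod X \<in> borel_measurable (lborel \<Otimes>\<^sub>M P)"
  using X_measurable by (simp cong: measurable_cong_sets sets_pair_measure_cong add: sets_lborel)

lemma X_slice_measurable [measurable]: "X t \<in> borel_measurable P"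
proof -
  have "(\<lambda>\<omega>. case_prod X (t, \<omega>)) \<in> borel_measurable P"
    by (rule measurable_compose[OF _ X_measurable]) measurable
  then show ?thesis by simp
qed

lemma C_nonneg: "0 \<le> C l"
  unfolding w_power[symmetric] by simp

lemma C_minus: "C (- l) = C l"
proof -
  have "(\<integral>\<omega>. (cmod (w (- l) \<omega>))\<^sup>2 \<partial>P) = (\<integral>\<omega>. (cmod (w l \<omega>))\<^sup>2 \<partial>P)"
    by (rule integral_cong_AE) (use w_conj[of l] in \<open>auto elim!: eventually_mono\<close>)
  then show ?thesis by (simp add: w_power)
qed

lemma cnj_measurable: "f \<in> borel_measurable M \<Longrightarrow> (\<lambda>x. cnj (f x)) \<in> borel_measurable M"
  by (rule borel_measurable_continuous_on[where f = cnj]) (auto intro!: continuous_intros)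

lemma integrable_w: "integrable P (w l)"
proof (rule Bochner_Integration.integrable_bound)
  show "integrable P (\<lambda>\<omega>. 1 + (cmod (w l \<omega>))\<^sup>2)" using w_square_integrable by simp
  have "x \<le> 1 + x\<^sup>2" for x :: real
    using sum_squares_ge_zero[of "x - 1/2" 0] by (simp add: power2_eq_square algebra_simps)
  then show "AE \<omega> in P. norm (w l \<omega>) \<le> norm (1 + (cmod (w l \<omega>))\<^sup>2)" by (simp add: add_nonneg_nonneg)
qed simp

lemma integrable_w_cnj_w: "integrable P (\<lambda>\<omega>. w l \<omega> * cnj (w l' \<omega>))"
proof (rule Bochner_Integration.integrable_bound)
  show "integrable P (\<lambda>\<omega>. (cmod (w l \<omega>))\<^sup>2 + (cmod (w l' \<omega>))\<^sup>2)" using w_square_integrable by simp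
  have "x * y \<le> x\<^sup>2 + y\<^sup>2" if "0 \<le> x" "0 \<le> y" for x y :: real
  proof -
    have "2 * (x * y) \<le> x\<^sup>2 + y\<^sup>2" using sum_squares_bound[of x y] by simp
    moreover have "0 \<le> x * y" using that by simp
    ultimately show ?thesis by linarith
  qed
  then show "AE \<omega> in P. norm (w l \<omega> * cnj (w l' \<omega>)) \<le> norm ((cmod (w l \<omega>))\<^sup>2 + (cmod (w l' \<omega>))\<^sup>2)"
    by (simp add: norm_mult)
  show "(\<lambda>\<omega>. w l \<omega> * cnj (w l' \<omega>)) \<in> borel_measurable P"
    by (intro borel_measurable_times cnj_measurable) auto
qed

lemma expectation_w_cnj_w:
  "(\<integral>\<omega>. w l \<omega> * cnj (w l' \<omega>) \<partial>P) = (if l = l' then of_real (C l) else 0)"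
proof (cases "l = l'")
  case True
  have "(\<integral>\<omega>. w l \<omega> * cnj (w l \<omega>) \<partial>P) = (\<integral>\<omega>. complex_of_real ((cmod (w l \<omega>))\<^sup>2) \<partial>P)"
    by (intro Bochner_Integration.integral_cong) (simp_all only: complex_norm_square)
  also have "\<dots> = of_real (C l)" by (simp only: integral_complex_of_real w_power)
  finally show ?thesis using True by simp
next
  case False
  \<comment> \<open>Conjugation reflects the index, which turns the uncorrelatedness assumption,
    stated without conjugates, into orthogonality for distinct indices.\<close>
  have "(\<integral>\<omega>. w l \<omega> * cnj (w l' \<omega>) \<partial>P) = (\<integral>\<omega>. w l \<omega> * w (- l') \<omega> \<partial>P)"
    by (rule integral_cong_AE)
       (use w_conj[of l'] in \<open>auto elim!: eventually_mono intro!: borel_measurable_times cnj_measurable\<close>)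
  then show ?thesis using False w_uncorrelated[of "- l'" l] by simp
qed

lemma expectation_lincomb:
  "(\<integral>\<omega>. (\<Sum>l\<in>A. c l * w l \<omega>) \<partial>P) = 0"
  by (subst Bochner_Integration.integral_sum) (simp_all add: integrable_w w_mean)

lemma expectation_lincomb_cnj:
  assumes "finite A"
  shows "(\<integral>\<omega>. (\<Sum>l\<in>A. c l * w l \<omega>) * cnj (\<Sum>l\<in>A. d l * w l \<omega>) \<partial>P)
      = (\<Sum>l\<in>A. c l * cnj (d l) * of_real (C l))"
proof -
  have "(\<integral>\<omega>. (\<Sum>l\<in>A. c l * w l \<omega>) * cnj (\<Sum>l\<in>A. d l * w l \<omega>) \<partial>P) =
      (\<integral>\<omega>. (\<Sum>l\<in>A. \<Sum>l'\<in>A. (c l * cnj (d l')) * (w l \<omega> * cnj (w l' \<omega>))) \<partial>P)"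
    by (intro Bochner_Integration.integral_cong) (simp_all add: sum_product mult_ac)
  also have "\<dots> = (\<Sum>l\<in>A. \<Sum>l'\<in>A. (c l * cnj (d l')) * (if l = l' then of_real (C l) else 0))"
    by (simp add: Bochner_Integration.integral_sum integrable_w_cnj_w expectation_w_cnj_w)
  also have "\<dots> = (\<Sum>l\<in>A. c l * cnj (d l) * of_real (C l))"
    using assms by (simp add: if_distrib cong: if_cong)
  finally show ?thesis .
qed

section \<open>Fourier coefficients of the paths\<close>

definition partial_field :: "nat \<Rightarrow> real \<Rightarrow> 'a \<Rightarrow> complex" where
  "partial_field n t \<omega> = (\<Sum>l\<in>{- int n..int n}. w l \<omega> * cis (of_int l * t))"

lemma partial_field_measurable [measurable]:
  "case_prod (partial_field n) \<in> borel_measurable (lborel \<Otimes>\<^sub>M P)"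
proof -
  have [measurable]: "(\<lambda>t. cis (of_int l * t)) \<in> borel_measurable lborel" for l
    by (simp add: borel_measurable_continuous_onI continuous_intros)
  show ?thesis unfolding partial_field_def[abs_def] by measurable
qed

lemma partial_field_slice_measurable [measurable]: "partial_field n t \<in> borel_measurable P"
  unfolding partial_field_def[abs_def] by measurable

text \<open>By orthogonality and \<open>cmod (cis x) = 1\<close>, the second moment is a partial sum
  of \<open>C\<close>, whatever the angle.\<close>

lemma nn_integral_partial_field_le:
  "(\<integral>\<^sup>+\<omega>. ennreal ((cmod (partial_field n t \<omega>))\<^sup>2) \<partial>P) \<le> ennreal (infsum C UNIV)"
proof -
  define S where "S \<omega> = (\<Sum>l\<in>{- int n..int n}. cis (of_int l * t) * w l \<omega>)" for \<omega>
  have S: "partial_field n t = S" by (auto simp: partial_field_def S_def mult.commute)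
  have "complex_of_real (\<integral>\<omega>. (cmod (S \<omega>))\<^sup>2 \<partial>P) = (\<integral>\<omega>. S \<omega> * cnj (S \<omega>) \<partial>P)"
    unfolding integral_complex_of_real[symmetric]
    by (intro Bochner_Integration.integral_cong) (simp_all only: complex_norm_square)
  also have "\<dots>
      = (\<Sum>l\<in>{- int n..int n}. cis (of_int l * t) * cnj (cis (of_int l * t)) * of_real (C l))"
    unfolding S_def by (rule expectation_lincomb_cnj) simp
  also have "\<dots> = of_real (\<Sum>l\<in>{- int n..int n}. C l)"
    by (simp add: cis_cnj cis_mult)
  finally have "(\<integral>\<omega>. (cmod (S \<omega>))\<^sup>2 \<partial>P) = (\<Sum>l\<in>{- int n..int n}. C l)"
    by (simp only: of_real_eq_iff)
  also have "\<dots> \<le> infsum C UNIV"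
    by (rule finite_sum_le_infsum) (use C_summable C_nonneg in auto)
  finally have *: "(\<integral>\<omega>. (cmod (S \<omega>))\<^sup>2 \<partial>P) \<le> infsum C UNIV" .
  have "integrable P (\<lambda>\<omega>. complex_of_real ((cmod (S \<omega>))\<^sup>2))"
  proof -
    have "(\<lambda>\<omega>. complex_of_real ((cmod (S \<omega>))\<^sup>2)) =
        (\<lambda>\<omega>. (\<Sum>l\<in>{- int n..int n}. \<Sum>l'\<in>{- int n..int n}.
          (cis (of_int l * t) * cnj (cis (of_int l' * t))) * (w l \<omega> * cnj (w l' \<omega>))))"
      unfolding complex_norm_square S_def by (simp add: sum_product mult_ac)
    then show ?thesis
      by (simp only:) (intro Bochner_Integration.integrable_sum integrable_mult_right integrable_w_cnj_w)
  qed
  then have "integrable P (\<lambda>\<omega>. (cmod (S \<omega>))\<^sup>2)"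
    by (simp only: complex_of_real_integrable_eq)
  then have "(\<integral>\<^sup>+\<omega>. ennreal ((cmod (S \<omega>))\<^sup>2) \<partial>P) = ennreal (\<integral>\<omega>. (cmod (S \<omega>))\<^sup>2 \<partial>P)"
    by (intro nn_integral_eq_integral) auto
  then show ?thesis using * by (simp add: S ennreal_leI)
qed

lemma sq_add_le: "(x + y)\<^sup>2 \<le> 2 * x\<^sup>2 + 2 * (y::real)\<^sup>2"
  using sum_squares_bound[of x y] by (simp add: power2_sum)

text \<open>Some partial sum has mean square error below 1, and the partial sums themselves have
  finite second moment.\<close>

lemma integrable_X_sq: "integrable P (\<lambda>\<omega>. (X t \<omega>)\<^sup>2)"
proof -
  have "eventually (\<lambda>n. (\<integral>\<^sup>+\<omega>. ennreal ((cmod (of_real (X t \<omega>) - partial_field n t \<omega>))\<^sup>2) \<partial>P) < 1) sequentially"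
    using X_series[of t] unfolding partial_field_def by (rule order_tendstoD) simp
  then obtain n where n: "(\<integral>\<^sup>+\<omega>. ennreal ((cmod (of_real (X t \<omega>) - partial_field n t \<omega>))\<^sup>2) \<partial>P) < 1"
    by (auto simp: eventually_sequentially)
  have "(\<integral>\<^sup>+\<omega>. ennreal ((X t \<omega>)\<^sup>2) \<partial>P) \<le>
      (\<integral>\<^sup>+\<omega>. 2 * ennreal ((cmod (of_real (X t \<omega>) - partial_field n t \<omega>))\<^sup>2) +
        2 * ennreal ((cmod (partial_field n t \<omega>))\<^sup>2) \<partial>P)"
  proof (rule nn_integral_mono)
    fix \<omega>
    have "\<bar>X t \<omega>\<bar> \<le> cmod (of_real (X t \<omega>) - partial_field n t \<omega>) + cmod (partial_field n t \<omega>)"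
      using norm_triangle_ineq[of "of_real (X t \<omega>) - partial_field n t \<omega>" "partial_field n t \<omega>"]
        by simp
    then have "\<bar>X t \<omega>\<bar>\<^sup>2
        \<le> (cmod (of_real (X t \<omega>) - partial_field n t \<omega>) + cmod (partial_field n t \<omega>))\<^sup>2"
      by (rule power_mono) simp
    also note sq_add_le
    finally have "ennreal ((X t \<omega>)\<^sup>2)
        \<le> ennreal (2 * (cmod (of_real (X t \<omega>) - partial_field n t \<omega>))\<^sup>2 + 2 * (cmod (partial_field n t \<omega>))\<^sup>2)"
      by (intro ennreal_leI) simp
    then show "ennreal ((X t \<omega>)\<^sup>2)
        \<le> 2 * ennreal ((cmod (of_real (X t \<omega>) - partial_field n t \<omega>))\<^sup>2) +
        2 * ennreal ((cmod (partial_field n t \<omega>))\<^sup>2)"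
      by (simp add: ennreal_plus ennreal_mult)
  qed
  also have "\<dots> = 2 * (\<integral>\<^sup>+\<omega>. ennreal ((cmod (of_real (X t \<omega>) - partial_field n t \<omega>))\<^sup>2) \<partial>P) +
        2 * (\<integral>\<^sup>+\<omega>. ennreal ((cmod (partial_field n t \<omega>))\<^sup>2) \<partial>P)"
    by (subst nn_integral_add) (simp_all add: nn_integral_cmult)
  also have "\<dots> < \<infinity>"
  proof -
    have "(\<integral>\<^sup>+\<omega>. ennreal ((cmod (partial_field n t \<omega>))\<^sup>2) \<partial>P) < \<infinity>"
      using nn_integral_partial_field_le[of n t] by (auto simp: top_unique less_top[symmetric])
    moreover have "(\<integral>\<^sup>+\<omega>. ennreal ((cmod (of_real (X t \<omega>) - partial_field n t \<omega>))\<^sup>2) \<partial>P) < \<infinity>"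
      using n by (simp add: order.strict_trans[OF n])
    ultimately show ?thesis by (simp add: ennreal_mult_less_top)
  qed
  finally show ?thesis by (intro integrableI_bounded) simp_all
qed

text \<open>Stationarity makes the bound uniform in \<open>t\<close>, as dominated convergence in \<open>t\<close> requires.\<close>

lemma mean_square_error_le:
  obtains K :: real where
    "\<And>n t. (\<integral>\<^sup>+\<omega>. ennreal ((cmod (of_real (X t \<omega>) - partial_field n t \<omega>))\<^sup>2) \<partial>P) \<le> ennreal K"
proof
  fix n t
  have "(\<integral>\<omega>. X (0 + t) \<omega> * X (0 + t) \<omega> \<partial>P) = (\<integral>\<omega>. X 0 \<omega> * X 0 \<omega> \<partial>P)"
    using X_stationary unfolding wide_sense_stationary_def by blast
  then have X: "(\<integral>\<omega>. (X t \<omega>)\<^sup>2 \<partial>P) = (\<integral>\<omega>. (X 0 \<omega>)\<^sup>2 \<partial>P)" by (simp add: power2_eq_square)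
  have "(\<integral>\<^sup>+\<omega>. ennreal ((cmod (of_real (X t \<omega>) - partial_field n t \<omega>))\<^sup>2) \<partial>P) \<le>
      (\<integral>\<^sup>+\<omega>. 2 * ennreal ((X t \<omega>)\<^sup>2) + 2 * ennreal ((cmod (partial_field n t \<omega>))\<^sup>2) \<partial>P)"
  proof (rule nn_integral_mono)
    fix \<omega>
    have "cmod (of_real (X t \<omega>) - partial_field n t \<omega>) \<le> \<bar>X t \<omega>\<bar> + cmod (partial_field n t \<omega>)"
      using norm_triangle_ineq4[of "of_real (X t \<omega>)" "partial_field n t \<omega>"] by simp
    then have "(cmod (of_real (X t \<omega>) - partial_field n t \<omega>))\<^sup>2
        \<le> (\<bar>X t \<omega>\<bar> + cmod (partial_field n t \<omega>))\<^sup>2"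
      by (rule power_mono) simp
    also note sq_add_le
    finally have "ennreal ((cmod (of_real (X t \<omega>) - partial_field n t \<omega>))\<^sup>2)
        \<le> ennreal (2 * (X t \<omega>)\<^sup>2 + 2 * (cmod (partial_field n t \<omega>))\<^sup>2)"
      by (intro ennreal_leI) simp
    then show "ennreal ((cmod (of_real (X t \<omega>) - partial_field n t \<omega>))\<^sup>2)
        \<le> 2 * ennreal ((X t \<omega>)\<^sup>2) +
        2 * ennreal ((cmod (partial_field n t \<omega>))\<^sup>2)"
      by (simp add: ennreal_plus ennreal_mult)
  qed
  also have "\<dots>
      = 2 * (\<integral>\<^sup>+\<omega>. ennreal ((X t \<omega>)\<^sup>2) \<partial>P) + 2 * (\<integral>\<^sup>+\<omega>. ennreal ((cmod (partial_field n t \<omega>))\<^sup>2) \<partial>P)"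
    by (subst nn_integral_add) (simp_all add: nn_integral_cmult)
  also have "(\<integral>\<^sup>+\<omega>. ennreal ((X t \<omega>)\<^sup>2) \<partial>P) = ennreal (\<integral>\<omega>. (X 0 \<omega>)\<^sup>2 \<partial>P)"
    unfolding X[symmetric] by (intro nn_integral_eq_integral integrable_X_sq) simp
  also have "2 * ennreal (\<integral>\<omega>. (X 0 \<omega>)\<^sup>2 \<partial>P) + 2 * (\<integral>\<^sup>+\<omega>. ennreal ((cmod (partial_field n t \<omega>))\<^sup>2) \<partial>P)
      \<le> 2 * ennreal (\<integral>\<omega>. (X 0 \<omega>)\<^sup>2 \<partial>P) + 2 * ennreal (infsum C UNIV)"
    by (intro add_left_mono mult_left_mono nn_integral_partial_field_le) simp
  also have "\<dots> = ennreal (2 * (\<integral>\<omega>. (X 0 \<omega>)\<^sup>2 \<partial>P) + 2 * infsum C UNIV)"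
    using infsum_nonneg[of UNIV C] C_nonneg by (simp add: ennreal_plus ennreal_mult)
  finally show "(\<integral>\<^sup>+\<omega>. ennreal ((cmod (of_real (X t \<omega>) - partial_field n t \<omega>))\<^sup>2) \<partial>P)
      \<le> ennreal (2 * (\<integral>\<omega>. (X 0 \<omega>)\<^sup>2 \<partial>P) + 2 * infsum C UNIV)" .
qed

interpretation lborel_P: pair_sigma_finite lborel P ..

lemma error_measurable [measurable]:
  "(\<lambda>z. of_real (X (fst z) (snd z)) - partial_field n (fst z) (snd z)) \<in> borel_measurable (lborel \<Otimes>\<^sub>M P)"
  using X_measurable' partial_field_measurable[of n] by (simp add: case_prod_beta')

text \<open>One quantity that dominates all Fourier coefficients of the error at once. It takes
  values in \<open>ennreal\<close> because integrability of the paths is only deduced from its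
  finiteness, almost surely.\<close>

definition L1_error :: "nat \<Rightarrow> 'a \<Rightarrow> ennreal" where
  "L1_error n \<omega>
      = (\<integral>\<^sup>+t. ennreal (cmod (of_real (X t \<omega>) - partial_field n t \<omega>)) * indicator {-pi..pi} t \<partial>lborel)"

lemma L1_error_measurable [measurable]: "L1_error n \<in> borel_measurable P"
proof -
  have "(\<lambda>z. (\<lambda>(t, \<omega>). of_real (X t \<omega>) - partial_field n t \<omega>) (snd z, fst z)) \<in> borel_measurable (P \<Otimes>\<^sub>M lborel)"
    using measurable_compose[OF measurable_pair_swap' error_measurable[of n]]
      by (simp add: case_prod_beta')
  then have [measurable]:
      "(\<lambda>z. of_real (X (snd z) (fst z)) - partial_field n (snd z) (fst z)) \<in> borel_measurable (P \<Otimes>\<^sub>M lborel)"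
    by simp
  have "(\<lambda>z. ennreal (cmod (of_real (X (snd z) (fst z)) - partial_field n (snd z) (fst z))) * indicator {-pi..pi} (snd z))
      \<in> borel_measurable (P \<Otimes>\<^sub>M lborel)"
    by measurable
  then have "(\<lambda>\<omega>. \<integral>\<^sup>+t. ennreal (cmod (of_real (X t \<omega>) - partial_field n t \<omega>)) * indicator {-pi..pi} t \<partial>lborel)
      \<in> borel_measurable P"
    by (intro lborel.borel_measurable_nn_integral) (simp add: case_prod_beta')
  then show ?thesis by (simp add: L1_error_def[abs_def])
qed

text \<open>Dominated convergence in the angle makes the integrated mean square error tend to 0, and
  Cauchy-Schwarz on the product space passes from L2 to L1. The square is kept since that is what
  Cauchy-Schwarz bounds.\<close>

lemma L1_error_tendsto: "(\<lambda>n. (\<integral>\<^sup>+\<omega>. L1_error n \<omega> \<partial>P)\<^sup>2) \<longlonglongrightarrow> 0"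
  and L1_error_finite: "(\<integral>\<^sup>+\<omega>. L1_error n \<omega> \<partial>P) < \<infinity>"
proof -
  define f where "f n z
      = ennreal (cmod (of_real (X (fst z) (snd z)) - partial_field n (fst z) (snd z)))" for n and z :: "real \<times> 'a"
  define I where "I z = (indicator {-pi..pi} (fst z) :: ennreal)" for z :: "real \<times> 'a"
  have [measurable]: "f n \<in> borel_measurable (lborel \<Otimes>\<^sub>M P)" for n unfolding f_def by measurable
  have [measurable]: "I \<in> borel_measurable (lborel \<Otimes>\<^sub>M P)" unfolding I_def by measurable
  define e where "e n = (\<integral>\<^sup>+z. (f n z)\<^sup>2 * I z \<partial>(lborel \<Otimes>\<^sub>M P))" for n
  obtain K where K: "\<And>n t. (\<integral>\<^sup>+\<omega>. (f n (t, \<omega>))\<^sup>2 \<partial>P) \<le> ennreal K"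
    using mean_square_error_le by (auto simp: f_def ennreal_power)
  have e: "e n = (\<integral>\<^sup>+t. (\<integral>\<^sup>+\<omega>. (f n (t, \<omega>))\<^sup>2 \<partial>P) * indicator {-pi..pi} t \<partial>lborel)" for n
    unfolding e_def by (subst nn_integral_fst[symmetric]) (simp_all add: I_def nn_integral_multc)
  have meas: "(\<lambda>t. (\<integral>\<^sup>+\<omega>. (f n (t, \<omega>))\<^sup>2 \<partial>P) * indicator {-pi..pi} t) \<in> borel_measurable lborel"
    for n
    by measurable
  have e_le: "e n \<le> ennreal K * ennreal (2 * pi)" for n
  proof -
    have "e n \<le> (\<integral>\<^sup>+t. ennreal K * indicator {-pi..pi} t \<partial>lborel)"
      unfolding e by (intro nn_integral_mono mult_right_mono K) simp
    also have "\<dots> = ennreal K * ennreal (2 * pi)" by (simp add: nn_integral_cmult)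
    finally show ?thesis .
  qed
  have e_lim: "e \<longlonglongrightarrow> 0"
  proof -
    have "(\<lambda>n. \<integral>\<^sup>+t. (\<integral>\<^sup>+\<omega>. (f n (t, \<omega>))\<^sup>2 \<partial>P) * indicator {-pi..pi} t \<partial>lborel) \<longlonglongrightarrow> (\<integral>\<^sup>+t. 0 \<partial>(lborel :: real measure))"
    proof (rule nn_integral_dominated_convergence[where w =
        "\<lambda>t. ennreal K * indicator {-pi..pi} t"])
      show "(\<integral>\<^sup>+t. ennreal K * indicator {-pi..pi} t \<partial>lborel) < \<infinity>"
        by (simp add: nn_integral_cmult ennreal_mult_less_top)
      have "(\<lambda>n. (\<integral>\<^sup>+\<omega>. (f n (t, \<omega>))\<^sup>2 \<partial>P) * indicator {-pi..pi} t) \<longlonglongrightarrow> 0" for t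
      proof (rule tendsto_sandwich[of "\<lambda>_. 0"])
        show "eventually (\<lambda>n. (\<integral>\<^sup>+\<omega>. (f n (t, \<omega>))\<^sup>2 \<partial>P) * indicator {-pi..pi} t
            \<le> (\<integral>\<^sup>+\<omega>. (f n (t, \<omega>))\<^sup>2 \<partial>P)) sequentially"
          by (auto simp: indicator_def)
        show "(\<lambda>n. \<integral>\<^sup>+\<omega>. (f n (t, \<omega>))\<^sup>2 \<partial>P) \<longlonglongrightarrow> 0"
          using X_series[of t] by (simp add: f_def ennreal_power partial_field_def)
      qed auto
      then show "AE t in lborel. (\<lambda>n. (\<integral>\<^sup>+\<omega>. (f n (t, \<omega>))\<^sup>2 \<partial>P) * indicator {-pi..pi} t) \<longlonglongrightarrow> 0"
        by simp
      show "AE t in lborel. (\<integral>\<^sup>+\<omega>. (f n (t, \<omega>))\<^sup>2 \<partial>P) * indicator {-pi..pi} t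
          \<le> ennreal K * indicator {-pi..pi} t" for n
        by (intro AE_I2 mult_right_mono K) simp
    qed (use meas in auto)
    then show ?thesis by (simp add: e[abs_def])
  qed
  \<comment> \<open>The idempotent indicator is doubled: one copy localises the error, the other is
    the second factor in Cauchy-Schwarz.\<close>
  have L: "(\<integral>\<^sup>+\<omega>. L1_error n \<omega> \<partial>P) = (\<integral>\<^sup>+z. (f n z * I z) * I z \<partial>(lborel \<Otimes>\<^sub>M P))" for n
    by (subst lborel_P.nn_integral_snd[symmetric])
       (auto simp: L1_error_def f_def I_def indicator_def intro!: nn_integral_cong)
  have I2: "(\<integral>\<^sup>+z. (I z)\<^sup>2 \<partial>(lborel \<Otimes>\<^sub>M P)) = ennreal (2 * pi)"
  proof -
    have "(\<integral>\<^sup>+z. (I z)\<^sup>2 \<partial>(lborel \<Otimes>\<^sub>M P)) = (\<integral>\<^sup>+z. I z \<partial>(lborel \<Otimes>\<^sub>M P))"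
      by (intro nn_integral_cong) (simp add: I_def indicator_def)
    also have "\<dots> = (\<integral>\<^sup>+t. indicator {-pi..pi} t \<partial>lborel)"
      by (subst nn_integral_fst[symmetric]) (simp_all add: I_def emeasure_space_1)
    finally show ?thesis by simp
  qed
  have CS: "(\<integral>\<^sup>+\<omega>. L1_error n \<omega> \<partial>P)\<^sup>2 \<le> e n * ennreal (2 * pi)" for n
  proof -
    have "(\<integral>\<^sup>+z. (f n z * I z) * I z \<partial>(lborel \<Otimes>\<^sub>M P))\<^sup>2 \<le>
        (\<integral>\<^sup>+z. (f n z * I z)\<^sup>2 \<partial>(lborel \<Otimes>\<^sub>M P)) * (\<integral>\<^sup>+z. (I z)\<^sup>2 \<partial>(lborel \<Otimes>\<^sub>M P))"
      by (rule Cauchy_Schwarz_nn_integral) measurable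
    also have "(\<integral>\<^sup>+z. (f n z * I z)\<^sup>2 \<partial>(lborel \<Otimes>\<^sub>M P)) = e n"
      unfolding e_def by (intro nn_integral_cong) (simp add: I_def indicator_def)
    finally show ?thesis by (simp add: L I2)
  qed
  have "(\<integral>\<^sup>+\<omega>. L1_error n \<omega> \<partial>P)\<^sup>2 < \<infinity>"
  proof -
    have "(\<integral>\<^sup>+\<omega>. L1_error n \<omega> \<partial>P)\<^sup>2 \<le> ennreal K * ennreal (2 * pi) * ennreal (2 * pi)"
      by (rule order_trans[OF CS mult_right_mono[OF e_le]]) simp
    also have "\<dots> < \<infinity>" by (simp add: ennreal_mult_less_top)
    finally show ?thesis .
  qed
  then show "(\<integral>\<^sup>+\<omega>. L1_error n \<omega> \<partial>P) < \<infinity>"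
    by (simp add: power_less_top_ennreal)
  have "(\<lambda>n. ennreal (2 * pi) * e n) \<longlonglongrightarrow> ennreal (2 * pi) * 0"
    by (intro ennreal_tendsto_cmult e_lim) simp
  then have lim: "(\<lambda>n. e n * ennreal (2 * pi)) \<longlonglongrightarrow> 0" by (simp add: mult.commute)
  then show "(\<lambda>n. (\<integral>\<^sup>+\<omega>. L1_error n \<omega> \<partial>P)\<^sup>2) \<longlonglongrightarrow> 0"
    by (intro tendsto_sandwich[OF _ _ tendsto_const lim] always_eventually allI CS) simp
qed

text \<open>For \<open>n\<close> at least \<open>\<bar>l\<bar>\<close> the partial sum has exactly
  the coefficient \<open>2 * pi * w (- l)\<close>, so the discrepancy is a Fourier coefficient of
  the error and is bounded by its L1 norm. The sign of \<open>- l\<close> arises because the kernel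
  is not conjugated.\<close>

lemma fourier_coeff_error:
  assumes "L1_error n \<omega> < \<infinity>" "\<omega> \<in> space P" "\<bar>l\<bar> \<le> int n"
  shows "set_integrable lborel {-pi..pi} (\<lambda>t. complex_of_real (X t \<omega>))"
    and "ennreal (cmod ((LINT t:{-pi..pi}|lborel. complex_of_real (X t \<omega>) * cis (of_int l * t)) - 2 * pi * w (- l) \<omega>))
      \<le> L1_error n \<omega>"
proof -
  define E where "E t = complex_of_real (X t \<omega>) - partial_field n t \<omega>" for t
  have "(\<lambda>t. (t, \<omega>)) \<in> lborel \<rightarrow>\<^sub>M lborel \<Otimes>\<^sub>M P" using assms(2) by measurable
  from measurable_compose[OF this error_measurable[of n]] have E_meas [measurable]:
      "E \<in> borel_measurable lborel"
    by (simp add: E_def[abs_def])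
  have E_int: "set_integrable lborel {-pi..pi} E"
    unfolding set_integrable_def
  proof (rule integrableI_bounded)
    have "(\<integral>\<^sup>+t. ennreal (norm (indicator {-pi..pi} t *\<^sub>R E t)) \<partial>lborel) = L1_error n \<omega>"
      unfolding L1_error_def E_def by (intro nn_integral_cong) (simp add: indicator_def)
    then show "(\<integral>\<^sup>+t. ennreal (norm (indicator {-pi..pi} t *\<^sub>R E t)) \<partial>lborel) < \<infinity>" using assms
      by simp
  qed measurable
  have pf_cont: "continuous_on {-pi..pi} (\<lambda>t. partial_field n t \<omega>)"
    unfolding partial_field_def by (intro continuous_intros)
  have "set_integrable lborel {-pi..pi} (\<lambda>t. E t + partial_field n t \<omega>)"
    by (intro set_integral_add(1) E_int borel_integrable_atLeastAtMost'[OF pf_cont])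
  then show X_int: "set_integrable lborel {-pi..pi} (\<lambda>t. complex_of_real (X t \<omega>))"
    by (simp add: E_def)
  have cis_meas [measurable]: "(\<lambda>t. cis (of_int l * t)) \<in> borel_measurable lborel"
    by (simp add: borel_measurable_continuous_onI continuous_intros)
  have Ec_int: "set_integrable lborel {-pi..pi} (\<lambda>t. E t * cis (of_int l * t))"
    unfolding set_integrable_def
    by (rule Bochner_Integration.integrable_bound[OF E_int[unfolded set_integrable_def]]) (auto simp: norm_mult)
  have Sc: "(LINT t:{-pi..pi}|lborel. partial_field n t \<omega> * cis (of_int l * t))
      = 2 * pi * w (- l) \<omega>"
  proof -
    have "(LINT t:{-pi..pi}|lborel. partial_field n t \<omega> * cis (of_int l * t)) =
        (LINT t:{-pi..pi}|lborel. (\<Sum>k\<in>{- int n..int n}. w k \<omega> * cis (of_int (k + l) * t)))"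
      by (intro set_lebesgue_integral_cong)
         (auto simp: partial_field_def sum_distrib_right mult.assoc cis_mult distrib_right intro!: sum.cong)
    also have "\<dots> = (\<Sum>k\<in>{- int n..int n}. LINT t:{-pi..pi}|lborel. w k \<omega> * cis (of_int (k + l) * t))"
      unfolding set_lebesgue_integral_def scaleR_sum_right
      by (intro Bochner_Integration.integral_sum, fold set_integrable_def,
          intro borel_integrable_atLeastAtMost' continuous_intros)
    also have "\<dots> = (\<Sum>k\<in>{- int n..int n}. if k = - l then 2 * pi * w (- l) \<omega> else 0)"
      by (intro sum.cong) (auto simp: set_integral_mult_right integral_cis simp del: of_int_add)
    also have "\<dots> = 2 * pi * w (- l) \<omega>" using assms(3) by (auto simp: abs_le_iff)
    finally show ?thesis .
  qed
  have "(LINT t:{-pi..pi}|lborel. complex_of_real (X t \<omega>) * cis (of_int l * t)) =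
      (LINT t:{-pi..pi}|lborel. E t * cis (of_int l * t) + partial_field n t \<omega> * cis (of_int l * t))"
    by (intro set_lebesgue_integral_cong) (auto simp: E_def algebra_simps)
  also have "\<dots> = (LINT t:{-pi..pi}|lborel. E t * cis (of_int l * t)) + 2 * pi * w (- l) \<omega>"
    unfolding Sc[symmetric]
    by (intro set_integral_add(2) Ec_int borel_integrable_atLeastAtMost' continuous_intros pf_cont)
  finally have "(LINT t:{-pi..pi}|lborel. complex_of_real (X t \<omega>) * cis (of_int l * t)) - 2 * pi * w (- l) \<omega> =
      (LINT t:{-pi..pi}|lborel. E t * cis (of_int l * t))" by simp
  moreover have "ennreal (cmod (LINT t:{-pi..pi}|lborel. E t * cis (of_int l * t))) \<le>
      (\<integral>\<^sup>+t. ennreal (norm (indicator {-pi..pi} t *\<^sub>R (E t * cis (of_int l * t)))) \<partial>lborel)"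
    unfolding set_lebesgue_integral_def
    by (rule integral_norm_bound_ennreal[OF Ec_int[unfolded set_integrable_def]])
  moreover have "\<dots> = L1_error n \<omega>"
    unfolding L1_error_def E_def by (intro nn_integral_cong) (simp add: indicator_def norm_mult)
  ultimately show
      "ennreal (cmod ((LINT t:{-pi..pi}|lborel. complex_of_real (X t \<omega>) * cis (of_int l * t)) - 2 * pi * w (- l) \<omega>))
      \<le> L1_error n \<omega>" by simp
qed

lemma AE_L1_error_finite: "AE \<omega> in P. L1_error n \<omega> < \<infinity>"
  using nn_integral_PInf_AE[OF L1_error_measurable, of n] L1_error_finite[of n]
  by (auto simp: less_top elim!: eventually_mono)

lemma AE_X_integrable: "AE \<omega> in P. set_integrable lborel {-pi..pi} (\<lambda>t. complex_of_real (X t \<omega>))"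
  using AE_L1_error_finite[of 0] AE_space
    by eventually_elim (use fourier_coeff_error(1)[of 0 _ 0] in auto)

lemma measurable_X_integral:
  assumes [measurable]: "\<psi> \<in> borel_measurable borel"
  shows "(\<lambda>\<omega>. LINT t:{-pi..pi}|lborel. complex_of_real (X t \<omega>) * \<psi> t) \<in> borel_measurable P"
proof -
  have [measurable]: "(\<lambda>z. X (snd z) (fst z)) \<in> borel_measurable (P \<Otimes>\<^sub>M lborel)"
    using measurable_compose[OF measurable_pair_swap' X_measurable'] by (simp add: case_prod_beta')
  have "(\<lambda>z. indicat_real {-pi..pi} (snd z) *\<^sub>R (complex_of_real (X (snd z) (fst z)) * \<psi> (snd z)))
      \<in> borel_measurable (P \<Otimes>\<^sub>M lborel)"
    by measurable
  then show ?thesis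
    unfolding set_lebesgue_integral_def
    by (intro lborel.borel_measurable_lebesgue_integral) (simp add: case_prod_beta')
qed

text \<open>The expected discrepancy does not depend on \<open>n\<close>, yet it is at most the
  expected L1 error for all large \<open>n\<close>; so it is 0.\<close>

lemma AE_fourier_coeff:
  "AE \<omega> in P. (LINT t:{-pi..pi}|lborel. complex_of_real (X t \<omega>) * cis (of_int l * t))
      = 2 * pi * w (- l) \<omega>"
proof -
  define d where "d \<omega>
      = cmod ((LINT t:{-pi..pi}|lborel. complex_of_real (X t \<omega>) * cis (of_int l * t)) - 2 * pi * w (- l) \<omega>)" for \<omega>
  have "(\<lambda>\<omega>. LINT t:{-pi..pi}|lborel. complex_of_real (X t \<omega>) * cis (of_int l * t)) \<in> borel_measurable P"
    by (intro measurable_X_integral borel_measurable_continuous_onI continuous_intros)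
  then have [measurable]: "d \<in> borel_measurable P" unfolding d_def[abs_def] by measurable
  have "(\<integral>\<^sup>+\<omega>. ennreal (d \<omega>) \<partial>P)\<^sup>2 \<le> (\<integral>\<^sup>+\<omega>. L1_error n \<omega> \<partial>P)\<^sup>2" if "\<bar>l\<bar> \<le> int n" for n
  proof (rule power_mono, rule nn_integral_mono_AE)
    show "AE \<omega> in P. ennreal (d \<omega>) \<le> L1_error n \<omega>"
      using AE_L1_error_finite[of n] AE_space
      by eventually_elim (unfold d_def, rule fourier_coeff_error(2), use that in auto)
  qed simp
  then have "eventually (\<lambda>n. (\<integral>\<^sup>+\<omega>. ennreal (d \<omega>) \<partial>P)\<^sup>2 \<le> (\<integral>\<^sup>+\<omega>. L1_error n \<omega> \<partial>P)\<^sup>2) sequentially"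
    by (intro eventually_sequentiallyI[of "nat \<bar>l\<bar>"]) auto
  from tendsto_lowerbound[OF L1_error_tendsto this]
  have "(\<integral>\<^sup>+\<omega>. ennreal (d \<omega>) \<partial>P) = 0" by simp
  then have "AE \<omega> in P. ennreal (d \<omega>) = 0" by (subst (asm) nn_integral_0_iff_AE) auto
  then show ?thesis by eventually_elim (simp add: d_def)
qed

end

section \<open>Wavelet coefficients as finite combinations of the weights\<close>

lemma wavelet_eq_sum:
  assumes "N > 0" "\<And>\<xi>. \<bar>\<xi>\<bar> > 2 \<Longrightarrow> a \<xi> = 0"
  shows "wavelet a N t = complex_of_real (1 / sqrt (real N)) *
     (\<Sum>l\<in>{- int N..int N}. complex_of_real (a (4 * of_int l / real N)) * cis (of_int l * t))"
proof -
  have "(\<Sum>\<^sub>\<infinity>l::int. complex_of_real (a (4 * of_int l / real N)) * cis (of_int l * t)) =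
      (\<Sum>\<^sub>\<infinity>l\<in>{- int N..int N}. complex_of_real (a (4 * of_int l / real N)) * cis (of_int l * t))"
  proof (rule infsum_cong_neutral)
    fix l assume l: "l \<in> UNIV - {- int N..int N}"
    then have "real N < \<bar>real_of_int l\<bar>" by (auto simp: abs_if)
    then have "\<bar>4 * real_of_int l / real N\<bar> > 2" using assms(1) by (simp add: abs_mult field_simps)
    then show "complex_of_real (a (4 * of_int l / real N)) * cis (of_int l * t) = 0"
      using assms(2) by simp
  qed auto
  then show ?thesis by (simp add: wavelet_def)
qed

lemma (in torus_field) covariance_wavelet_coeff:
  assumes N: "N > 0" and a: "\<And>\<xi>. \<bar>\<xi>\<bar> > 2 \<Longrightarrow> a \<xi> = 0" "\<And>\<xi>. a (- \<xi>) = a \<xi>"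
  shows "covariance P (wavelet_coeff a X N k1) (wavelet_coeff a X N k2) =
    (\<Sum>l\<in>{- int N..int N}. of_real (C l * (a (4 * of_int l / real N))\<^sup>2) *
      cis (of_int l * (2 * pi / real N * (real k1 - real k2)))) / of_nat N"
proof -
  \<comment> \<open>The coefficient of \<open>w l\<close> in the wavelet coefficient at location
    \<open>k\<close>. Integration against \<open>cis (l * t)\<close> selects \<open>w (- l)\<close>,
    so the wavelet itself is expanded with \<open>b k (- l)\<close>; evenness of \<open>a\<close>
    permits this.\<close>
  define b where "b k l
      = complex_of_real (1 / sqrt (real N) * a (4 * of_int l / real N)) * cis (of_int l * (real k * (2 * pi / real N)))" for k l
  have wav: "wavelet a N t = complex_of_real (1 / sqrt (real N)) *
     (\<Sum>l\<in>{- int N..int N}. complex_of_real (a (4 * of_int l / real N)) * cis (of_int l * t))" for t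
    by (rule wavelet_eq_sum[OF N a(1)])
  have shift: "wavelet_shift a N k t = (\<Sum>l\<in>{- int N..int N}. b k (- l) * cis (of_int l * t))"
    for k t
    unfolding wavelet_shift_def wav b_def sum_distrib_left
    by (intro sum.cong) (simp_all add: a(2) mult.assoc cis_mult right_diff_distrib minus_divide_left[symmetric])
  have shift_meas: "wavelet_shift a N k \<in> borel_measurable borel" for k
    unfolding shift[abs_def] by (intro borel_measurable_continuous_onI continuous_intros)
  have meas: "wavelet_coeff a X N k \<in> borel_measurable P" for k
    unfolding wavelet_coeff_def[abs_def]
      by (intro borel_measurable_times borel_measurable_const measurable_X_integral shift_meas)
  define Y where "Y k \<omega> = (\<Sum>l\<in>{- int N..int N}. b k l * w l \<omega>)" for k \<omega>
  have Y_meas: "Y k \<in> borel_measurable P" for k unfolding Y_def[abs_def] by measurable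
  have AE_Y: "AE \<omega> in P. wavelet_coeff a X N k \<omega> = Y k \<omega>" for k
  proof -
    have "AE \<omega> in P. \<forall>l\<in>{- int N..int N}. (LINT t:{-pi..pi}|lborel. complex_of_real (X t \<omega>) * cis (of_int l * t)) = 2 * pi * w (- l) \<omega>"
      by (intro AE_finite_allI AE_fourier_coeff) simp
    then show ?thesis using AE_X_integrable
    proof eventually_elim
      case (elim \<omega>)
      have int: "set_integrable lborel {-pi..pi} (\<lambda>t. complex_of_real (X t \<omega>) * cis (of_int l * t))"
        for l
        unfolding set_integrable_def
      proof (rule Bochner_Integration.integrable_bound[OF elim(2)[unfolded set_integrable_def]])
        have "(\<lambda>t. cis (of_int l * t)) \<in> borel_measurable lborel"
          by (simp add: borel_measurable_continuous_onI continuous_intros)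
        from borel_measurable_times[OF borel_measurable_integrable[OF elim(2)[unfolded set_integrable_def]] this]
        show "(\<lambda>t. indicat_real {-pi..pi} t *\<^sub>R (complex_of_real (X t \<omega>) * cis (of_int l * t))) \<in> borel_measurable lborel"
          by simp
      qed (auto simp: norm_mult)
      have "(LINT t:{-pi..pi}|lborel. complex_of_real (X t \<omega>) * wavelet_shift a N k t) =
          (LINT t:{-pi..pi}|lborel. (\<Sum>l\<in>{- int N..int N}. b k (- l) * (complex_of_real (X t \<omega>) * cis (of_int l * t))))"
        unfolding shift by (intro set_lebesgue_integral_cong) (auto simp: sum_distrib_left mult_ac)
      also have "\<dots>
          = (\<Sum>l\<in>{- int N..int N}. LINT t:{-pi..pi}|lborel. b k (- l) * (complex_of_real (X t \<omega>) * cis (of_int l * t)))"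
        unfolding set_lebesgue_integral_def scaleR_sum_right
        by (intro Bochner_Integration.integral_sum, fold set_integrable_def, intro set_integrable_mult_right impI int)
      also have "\<dots> = (\<Sum>l\<in>{- int N..int N}. b k (- l) * (2 * pi * w (- l) \<omega>))"
        using elim(1) by (intro sum.cong) (simp_all add: set_integral_mult_right)
      also have "\<dots> = (\<Sum>l\<in>{- int N..int N}. b k l * (2 * pi * w l \<omega>))"
        by (rule sum.reindex_bij_witness[of _ uminus uminus]) auto
      also have "\<dots> = complex_of_real (2 * pi) * Y k \<omega>"
        unfolding Y_def sum_distrib_left by (intro sum.cong) auto
      finally show ?case by (simp add: wavelet_coeff_def)
    qed
  qed
  have mean: "(\<integral>\<omega>. wavelet_coeff a X N k \<omega> \<partial>P) = 0" for k
  proof -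
    have "(\<integral>\<omega>. wavelet_coeff a X N k \<omega> \<partial>P) = (\<integral>\<omega>. Y k \<omega> \<partial>P)"
      by (rule integral_cong_AE[OF meas Y_meas AE_Y])
    then show ?thesis by (simp add: Y_def expectation_lincomb)
  qed
  have "covariance P (wavelet_coeff a X N k1) (wavelet_coeff a X N k2) =
      (\<integral>\<omega>. Y k1 \<omega> * cnj (Y k2 \<omega>) \<partial>P)"
    unfolding covariance_def mean diff_zero
  proof (rule integral_cong_AE)
    show "AE \<omega> in P. wavelet_coeff a X N k1 \<omega> * cnj (wavelet_coeff a X N k2 \<omega>)
        = Y k1 \<omega> * cnj (Y k2 \<omega>)"
      using AE_Y[of k1] AE_Y[of k2] by eventually_elim simp
  qed (intro borel_measurable_times cnj_measurable meas Y_meas)+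
  also have "\<dots> = (\<Sum>l\<in>{- int N..int N}. b k1 l * cnj (b k2 l) * of_real (C l))"
    unfolding Y_def by (rule expectation_lincomb_cnj) simp
  also have "\<dots> = (\<Sum>l\<in>{- int N..int N}. of_real (C l * (a (4 * of_int l / real N))\<^sup>2) *
      cis (of_int l * (2 * pi / real N * (real k1 - real k2))) / of_nat N)"
  proof (rule sum.cong)
    fix l
    have sq: "complex_of_real (sqrt (real N)) * complex_of_real (sqrt (real N)) = of_nat N"
      by (simp flip: of_real_mult)
    have "cis (of_int l * (real k1 * (2 * pi / real N))) * cnj (cis (of_int l * (real k2 * (2 * pi / real N)))) =
        cis (of_int l * (2 * pi / real N * (real k1 - real k2)))"
      unfolding cis_cnj cis_mult
        by (rule arg_cong[where f = cis]) (use N in \<open>simp add: field_simps\<close>)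
    then show "b k1 l * cnj (b k2 l) * of_real (C l)
        = of_real (C l * (a (4 * of_int l / real N))\<^sup>2) *
      cis (of_int l * (2 * pi / real N * (real k1 - real k2))) / of_nat N"
      unfolding b_def complex_cnj_mult complex_cnj_complex_of_real sq[symmetric]
      by (simp add: power2_eq_square mult_ac)
  qed simp
  finally show ?thesis by (simp add: sum_divide_distrib)
qed

section \<open>Decay of correlations\<close>

lemma sum_symmetric_int:
  fixes f :: "int \<Rightarrow> 'b::comm_monoid_add"
  shows "(\<Sum>l\<in>{- int N..int N}. f l) = f 0 + (\<Sum>l=1..N. f (int l) + f (- int l))"
proof (induction N)
  case (Suc N)
  have "{- int (Suc N)..int (Suc N)}
      = insert (int (Suc N)) (insert (- int (Suc N)) {- int N..int N})" by auto
  then have "(\<Sum>l\<in>{- int (Suc N)..int (Suc N)}. f l) =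
      f (int (Suc N)) + (f (- int (Suc N)) + (\<Sum>l\<in>{- int N..int N}. f l))" by simp
  then show ?case by (simp add: Suc.IH ac_simps)
qed simp

text \<open>The frequencies \<open>l\<close> and \<open>- l\<close> combine to a cosine, so the
  covariance is real and the factor \<open>2 / N\<close> cancels against the variance. Returning to
  the modulus of a one-sided exponential sum gives the form that \<open>norm_trig_sum_le\<close>
  treats.\<close>

lemma (in torus_field) cmod_correlation_wavelet_coeff_le:
  assumes a: "wavelet_window \<phi> a" and N: "N > 0"
  defines "q \<equiv> \<lambda>l. C (int l) * (a (4 * real l / real N))\<^sup>2"
  shows "cmod (correlation P (wavelet_coeff a X N k1) (wavelet_coeff a X N k2))
    \<le> cmod (\<Sum>l<N. of_real (q l) * cis (2 * pi / real N * (real k1 - real k2)) ^ l) / (\<Sum>l<N. q l)"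
proof -
  have a_zero: "a \<xi> = 0" if "\<bar>\<xi>\<bar> > 2" for \<xi> using that by (intro wavelet_window_zero[OF a]) auto
  have a_even: "a (- \<xi>) = a \<xi>" for \<xi> using a unfolding wavelet_window_def by blast
  define S where "S \<theta> = (\<Sum>l<N. q l * cos (real l * \<theta>))" for \<theta>
  have cov: "covariance P (wavelet_coeff a X N k) (wavelet_coeff a X N k') =
      of_real (2 * S (2 * pi / real N * (real k - real k')) / real N)" for k k'
  proof -
    define \<theta> where "\<theta> = 2 * pi / real N * (real k - real k')"
    define Q where "Q l
        = complex_of_real (C l * (a (4 * of_int l / real N))\<^sup>2) * cis (of_int l * \<theta>)" for l
    have Q: "Q (int l) + Q (- int l) = of_real (2 * (q l * cos (real l * \<theta>)))" for l
      by (simp add: Q_def q_def C_minus a_even complex_eq_iff)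
    \<comment> \<open>The zeros of the window at 0 and 4 remove the central term and reconcile the
      index ranges \<open>{1..N}\<close> and \<open>{..<N}\<close>.\<close>
    have q0: "q 0 = 0" "q N = 0"
      using N wavelet_window_zero[OF a, of 0] wavelet_window_zero[OF a, of 4]
        by (simp_all add: q_def)
    have "(\<Sum>l\<in>{- int N..int N}. Q l) = (\<Sum>l=1..N. of_real (2 * (q l * cos (real l * \<theta>))))"
      unfolding sum_symmetric_int Q using Q[of 0] q0 by simp
    also have "\<dots> = (\<Sum>l<N. of_real (2 * (q l * cos (real l * \<theta>))))"
      using q0 by (intro sum.mono_neutral_cong) (auto simp: Suc_le_eq not_less le_less)
    also have "\<dots> = of_real (2 * S \<theta>)" by (simp add: S_def sum_distrib_left)
    finally have "(\<Sum>l\<in>{- int N..int N}. Q l) = of_real (2 * S \<theta>)" .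
    moreover have "covariance P (wavelet_coeff a X N k) (wavelet_coeff a X N k') =
        (\<Sum>l\<in>{- int N..int N}. Q l) / of_nat N"
      unfolding Q_def \<theta>_def
      by (rule covariance_wavelet_coeff[where a = a, OF N]) (erule a_zero, rule a_even)
    ultimately show ?thesis by (simp add: \<theta>_def)
  qed
  define D where "D = (\<Sum>l<N. q l)"
  define \<theta> where "\<theta> = 2 * pi / real N * (real k1 - real k2)"
  have D: "0 \<le> D" by (auto simp: D_def q_def C_nonneg intro!: sum_nonneg)
  have cov_same: "covariance P (wavelet_coeff a X N k) (wavelet_coeff a X N k)
      = of_real (2 * D / real N)" for k
    unfolding cov by (simp add: S_def D_def)
  have "sqrt (2 * D / real N * (2 * D / real N)) = 2 * D / real N"
    unfolding real_sqrt_abs2 using D by simp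
  then have "cmod (correlation P (wavelet_coeff a X N k1) (wavelet_coeff a X N k2)) =
      \<bar>2 * S \<theta> / real N\<bar> / (2 * D / real N)"
    unfolding correlation_def cov_same cov[of k1 k2] \<theta>_def[symmetric] Re_complex_of_real norm_divide norm_of_real
    using D by simp
  also have "\<dots> = \<bar>S \<theta>\<bar> / D" using N by (simp add: abs_mult)
  also have "\<dots> \<le> cmod (\<Sum>l<N. of_real (q l) * cis \<theta> ^ l) / D"
  proof (rule divide_right_mono[OF _ D])
    have "S \<theta> = Re (\<Sum>l<N. of_real (q l) * cis \<theta> ^ l)"
    proof -
      have "Re (cis \<theta> ^ l) = cos (real l * \<theta>)" for l by (simp only: Complex.DeMoivre cis.sel)
      then show ?thesis by (simp add: S_def)
    qed
    then show "\<bar>S \<theta>\<bar> \<le> cmod (\<Sum>l<N. of_real (q l) * cis \<theta> ^ l)"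
      by (simp only: abs_Re_le_cmod)
  qed
  finally show ?thesis by (simp add: D_def \<theta>_def)
qed

lemma (in torus_field) cmod_correlation_wavelet_coeff_le_1:
  assumes a: "wavelet_window \<phi> a" and N: "N > 0"
  shows "cmod (correlation P (wavelet_coeff a X N k1) (wavelet_coeff a X N k2)) \<le> 1"
proof -
  define q where "q l = C (int l) * (a (4 * real l / real N))\<^sup>2" for l
  have q: "0 \<le> q l" for l by (simp add: q_def C_nonneg)
  have "cmod (\<Sum>l<N. of_real (q l) * cis (2 * pi / real N * (real k1 - real k2)) ^ l) \<le> (\<Sum>l<N. q l)"
    by (rule sum_norm_le) (simp add: norm_mult norm_power q)
  then have "cmod (\<Sum>l<N. of_real (q l) * cis (2 * pi / real N * (real k1 - real k2)) ^ l) / (\<Sum>l<N. q l) \<le> 1"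
    using q by (intro divide_le_eq_1[THEN iffD2]) (auto simp: sum_nonneg less_le)
  then show ?thesis
    using cmod_correlation_wavelet_coeff_le[OF a N, of k1 k2] unfolding q_def by linarith
qed

theorem lemma3p2:
  fixes P :: "'a measure" and X :: "real \<Rightarrow> 'a \<Rightarrow> real" and w :: "int \<Rightarrow> 'a \<Rightarrow> complex"
    and C :: "int \<Rightarrow> real" and \<phi> a :: "real \<Rightarrow> real" and g :: "nat \<Rightarrow> real"
    and c1 c2 \<alpha> :: real and M :: nat
  assumes "torus_field P X w C"
    and "wavelet_window \<phi> a"
    and "assumption_A2 C g c1 c2 \<alpha> M"
  shows "\<exists>c>0. \<forall>j\<ge>1. let N = (2::nat) ^ (j + 2) in
    \<forall>k1<N. \<forall>k2<N.
      cmod (correlation P (wavelet_coeff a X N k1) (wavelet_coeff a X N k2))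
        \<le> 2 * c / (1 + real_of_int (centred_residue (int N div 2) (int k1 - int k2))) ^ M"
proof -
  interpret torus_field P X w C by (rule assms)
  note a = assms(2)
  have A1: "0 < c1" "c1 \<le> c2" "\<And>l. l \<ge> 1 \<Longrightarrow> c1 \<le> g l" "\<alpha> > 1"
    and C: "\<And>l. l \<ge> 1 \<Longrightarrow> C (int l) = g l * real l powr (- \<alpha>)"
    using assms(3) unfolding assumption_A2_def assumption_A1_def by auto
  obtain h B where B: "B > 0" and h: "\<And>j. j \<ge> 1 \<Longrightarrow> let N = 2 ^ (j + 2) in
           (\<forall>u\<in>{1/2..2}. h N u \<in> {c1 / c2..c2 / c1}) \<and>
           (\<forall>l\<in>{N div 8..N div 2}. h N (4 * real l / real N) = g l / g (N div 4)) \<and>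
           (\<exists>v. has_weak_deriv M {1/2..2} (h N) v \<and> (\<forall>u\<in>{1/2..2}. \<bar>v u\<bar> \<le> B))"
    using assms(3) unfolding assumption_A2_def by blast
  \<comment> \<open>A lower bound on [1/2, 2] for the weight h_N(u) u^-\<alpha>, using
    \<open>u \<le> 2\<close>.\<close>
  define \<kappa> where "\<kappa> = c1 / c2 * 2 powr (- \<alpha>)"
  have \<kappa>: "\<kappa> > 0" using A1 by (simp add: \<kappa>_def)
  \<comment> \<open>Keeping \<open>0 < M\<close> as a premise gives a \<open>K\<close> in every
    case; for \<open>M = 0\<close> the property is vacuous.\<close>
  obtain K where K: "0 \<le> K" "\<And>m h v l. 0 < M \<Longrightarrow> M < m \<Longrightarrow> (\<forall>u\<in>{1/2..2}. \<bar>h u\<bar> \<le> c2 / c1) \<Longrightarrow>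
      has_weak_deriv M {1/2..2} h v \<Longrightarrow> (\<forall>u\<in>{1/2..2}. \<bar>v u\<bar> \<le> B) \<Longrightarrow>
      \<bar>(fdiff 1 ^^ M) (\<lambda>l. let u = real l / (2 * real m) in h u * u powr (- \<alpha>) * (a u)\<^sup>2) l\<bar> \<le> K / real m ^ M"
  proof (cases "0 < M")
    case True
    have "0 \<le> c2 / c1" using A1 by simp
    show ?thesis
    proof (rule weighted_window_fdiff_le[OF a True \<open>0 \<le> c2 / c1\<close> less_imp_le[OF B], where p =
        "- \<alpha>"])
      fix K assume "0 \<le> K" and *: "\<And>m h v l. M < m \<Longrightarrow> (\<forall>u\<in>{1/2..2}. \<bar>h u\<bar> \<le> c2 / c1) \<Longrightarrow>
        has_weak_deriv M {1/2..2} h v \<Longrightarrow> (\<forall>u\<in>{1/2..2}. \<bar>v u\<bar> \<le> B) \<Longrightarrow>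
        \<bar>(fdiff 1 ^^ M) (\<lambda>l. let u = real l / (2 * real m) in h u * u powr (- \<alpha>) * (a u)\<^sup>2) l\<bar> \<le> K / real m ^ M"
      show ?thesis by (rule that[OF \<open>0 \<le> K\<close>]) (rule *)
    qed
  next
    case False
    show ?thesis by (rule that[of 0]) (use False in auto)
  qed
  \<comment> \<open>The 1 serves \<open>M = 0\<close> or zero residue. The second summand serves
    \<open>m \<le> M\<close>, where the residue is at most \<open>4 * m \<le> 4 * M\<close>. In the
    third, \<open>4 ^ M\<close> comes from the phase, and 16 is 8 from the \<open>N = 8 * m\<close>
    summands times 2 from the variance bound \<open>\<kappa> * m / 2\<close>.\<close>
  define c where "c = 1 + (1 + 4 * real M) ^ M + 4 ^ M * 16 * K / \<kappa>"
  have c_ge: "1 \<le> c" "(1 + 4 * real M) ^ M \<le> c" "4 ^ M * 16 * K / \<kappa> \<le> c"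
    using K(1) \<kappa> by (auto simp: c_def add_nonneg_nonneg)
  have "cmod (correlation P (wavelet_coeff a X N k1) (wavelet_coeff a X N k2))
        \<le> 2 * c / (1 + real_of_int (centred_residue (int N div 2) (int k1 - int k2))) ^ M"
    if j: "j \<ge> 1" and N: "N = 2 ^ (j + 2)" for j N k1 k2
  proof -
    define m :: nat where "m = 2 ^ (j - 1)"
    have N8: "N = 8 * m" using j by (cases j) (auto simp: N m_def)
    have m: "0 < m" by (simp add: m_def)
    define corr where "corr
        = cmod (correlation P (wavelet_coeff a X N k1) (wavelet_coeff a X N k2))"
    define b where "b = int (4 * m)"
    have b: "int N div 2 = b" "0 < b" using m by (auto simp: N8 b_def)
    define r where "r = centred_residue b (int k1 - int k2)"
    have "0 \<le> (int k1 - int k2 + b) mod (2 * b)" "(int k1 - int k2 + b) mod (2 * b) < 2 * b" using b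
      by auto
    then have r: "0 \<le> r" "r \<le> b" unfolding r_def centred_residue_def by linarith+
    have corr: "0 \<le> corr" "corr \<le> 1"
      using cmod_correlation_wavelet_coeff_le_1[OF a, of N k1 k2] m by (auto simp: corr_def N8)
    have "(1 + real_of_int r) ^ M * corr \<le> c"
    \<comment> \<open>The difference bound requires \<open>0 < M < m\<close>, and for
      \<open>r = 0\<close> the phase gives no gain. These cases rest on the trivial bound.\<close>
    proof (cases "M = 0 \<or> m \<le> M \<or> r = 0")
      case True
      have "(1 + real_of_int r) ^ M \<le> c"
      proof (cases "M = 0 \<or> r = 0")
        case False
        then have "m \<le> M" using True by simp
        have "real_of_int r \<le> real_of_int b" using r by (simp only: of_int_le_iff)
        also have "\<dots> \<le> 4 * real M" using \<open>m \<le> M\<close> by (simp add: b_def)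
        finally have "(1 + real_of_int r) ^ M \<le> (1 + 4 * real M) ^ M" using r
          by (intro power_mono) auto
        then show ?thesis using c_ge by linarith
      qed (use c_ge in auto)
      moreover have "(1 + real_of_int r) ^ M * corr \<le> (1 + real_of_int r) ^ M * 1"
        using corr r by (intro mult_left_mono) auto
      ultimately show ?thesis by linarith
    next
      case False
      then have M: "0 < M" "M < m" and r1: "1 \<le> r" using r by auto
      obtain v where hr: "\<And>u. u \<in> {1/2..2} \<Longrightarrow> c1 / c2 \<le> h N u \<and> h N u \<le> c2 / c1"
        and hg: "\<And>l. l \<in> {m..4*m} \<Longrightarrow> h N (real l / (2 * real m)) = g l / g (2 * m)"
        and v: "has_weak_deriv M {1/2..2} (h N) v" "\<forall>u\<in>{1/2..2}. \<bar>v u\<bar> \<le> B"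
        using h[OF j] unfolding N[symmetric] Let_def by (auto simp: N8)
      have "0 < c1 / c2" using A1 by simp
      then have h_nonneg: "0 \<le> h N u" if "u \<in> {1/2..2}" for u using hr[OF that] by linarith
      define f where "f l = (let u = real l / (2 * real m) in h N u * u powr (- \<alpha>) * (a u)\<^sup>2)"
        for l :: nat
      have f_zero: "f l = 0" if "l < m \<or> 4 * m < l" for l
      proof -
        have "a (real l / (2 * real m)) = 0"
          using that m by (intro wavelet_window_zero[OF a]) (auto simp: field_simps)
        then show ?thesis by (simp add: f_def)
      qed
      \<comment> \<open>The value of \<open>C\<close> at frequency \<open>N / 4 = 2 * m\<close>,
        that is at u = 1. Factoring it out leaves the normalised weights \<open>f\<close>, and it
        cancels in the correlation.\<close>
      define G where "G = g (2 * m) * real (2 * m) powr (- \<alpha>)"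
      have g_pos: "g (2 * m) > 0" using A1(1) A1(3)[of "2 * m"] m by linarith
      then have G: "G > 0" using m by (simp add: G_def)
      have q: "C (int l) * (a (4 * real l / real N))\<^sup>2 = G * f l" for l
      proof (cases "l \<in> {m..4*m}")
        case True
        then have l: "1 \<le> l" using m by simp
        have "real l powr (- \<alpha>) = (real l / (2 * real m)) powr (- \<alpha>) * real (2 * m) powr (- \<alpha>)"
          using m by (subst powr_mult[symmetric]) auto
        moreover have "4 * real l / real N = real l / (2 * real m)" by (simp add: N8)
        ultimately show ?thesis
          using g_pos by (simp add: C[OF l] f_def Let_def hg[OF True] G_def)
      next
        case False
        have "a (4 * real l / real N) = 0"
          using False m by (intro wavelet_window_zero[OF a]) (auto simp: N8 field_simps)
        moreover have "f l = 0" by (rule f_zero) (use False in auto)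
        ultimately show ?thesis by simp
      qed
      define z where "z = cis (2 * pi / real N * (real k1 - real k2))"
      define T where "T = cmod (\<Sum>l<N. of_real (f l) * z ^ l)"
      define F where "F = (\<Sum>l<N. f l)"
      have F: "\<kappa> * (real m / 2) \<le> F"
      proof -
        have "\<kappa> * (real m / 2) \<le> \<kappa> * (\<Sum>l<8*m. (a (real l / (2 * real m)))\<^sup>2)"
          using \<kappa> by (intro mult_left_mono sum_window_sq_ge[OF a m]) auto
        also have "\<dots> = (\<Sum>l<N. \<kappa> * (a (real l / (2 * real m)))\<^sup>2)" by (simp add: N8 sum_distrib_left)
        also have "\<dots> \<le> F" unfolding F_def
        proof (rule sum_mono)
          fix l
          define u where "u = real l / (2 * real m)"
          show "\<kappa> * (a (real l / (2 * real m)))\<^sup>2 \<le> f l"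
          proof (cases "u \<in> {1/2..2}")
            case True
            have "2 powr (- \<alpha>) \<le> u powr (- \<alpha>)" using True A1 by (intro powr_mono2') auto
            then have "\<kappa> \<le> h N u * u powr (- \<alpha>)"
              unfolding \<kappa>_def using hr[OF True] h_nonneg[OF True] A1 by (intro mult_mono) auto
            then show ?thesis by (simp add: f_def Let_def u_def[symmetric] mult_right_mono)
          next
            case False
            then have "a u = 0" by (intro wavelet_window_zero[OF a]) (auto simp: u_def)
            then show ?thesis by (simp add: f_def u_def)
          qed
        qed
        finally show ?thesis .
      qed
      have F_pos: "F > 0" using F \<kappa> m
        by (meson divide_pos_pos less_le_trans mult_pos_pos of_nat_0_less_iff zero_less_numeral)
      have "corr \<le> cmod (\<Sum>l<N. of_real (G * f l) * z ^ l) / (\<Sum>l<N. G * f l)"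
        using cmod_correlation_wavelet_coeff_le[OF a, of N k1 k2] m unfolding q corr_def z_def
          by (simp add: N8)
      also have "(\<Sum>l<N. of_real (G * f l) * z ^ l) = of_real G * (\<Sum>l<N. of_real (f l) * z ^ l)"
        by (simp add: sum_distrib_left mult.assoc)
      also have "(\<Sum>l<N. G * f l) = G * F" by (simp add: F_def sum_distrib_left)
      also have "cmod (of_real G * (\<Sum>l<N. of_real (f l) * z ^ l)) / (G * F) = T / F"
        using G by (simp add: norm_mult T_def)
      finally have corr_le: "corr \<le> T / F" .
      have "cmod (1 - z) ^ M * T \<le> (\<Sum>l<N. \<bar>(fdiff 1 ^^ M) f l\<bar>)"
        unfolding T_def by (rule norm_trig_sum_le) (use M in \<open>auto simp: z_def N8 intro!: f_zero\<close>)
      also have "\<dots> \<le> (\<Sum>l<N. K / real m ^ M)"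
      proof (rule sum_mono)
        fix l
        have "\<forall>u\<in>{1/2..2}. \<bar>h N u\<bar> \<le> c2 / c1" using hr h_nonneg by simp
        from K(2)[OF M this v] show "\<bar>(fdiff 1 ^^ M) f l\<bar> \<le> K / real m ^ M"
          unfolding f_def[abs_def] .
      qed
      also have "\<dots> = 8 * real m * K / real m ^ M" by (simp add: N8)
      finally have zT: "cmod (1 - z) ^ M * T \<le> 8 * real m * K / real m ^ M" .
      have "2 * real_of_int r / real_of_int b \<le> cmod (1 - z)"
        using cmod_one_minus_cis_ge[OF b(2), of "int k1 - int k2"]
          by (simp add: r_def z_def b_def N8)
      then have "2 * real_of_int r \<le> 4 * real m * cmod (1 - z)" using m
        by (simp add: b_def field_simps)
      \<comment> \<open>\<open>r \<ge> 1\<close> gives \<open>1 + r \<le> 2 * r\<close>.\<close>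
      then have "1 + real_of_int r \<le> 4 * real m * cmod (1 - z)" using r1 by linarith
      then have "(1 + real_of_int r) ^ M \<le> (4 * real m * cmod (1 - z)) ^ M" using r
        by (intro power_mono) auto
      then have "(1 + real_of_int r) ^ M * T \<le> (4 * real m * cmod (1 - z)) ^ M * T"
        by (rule mult_right_mono) (simp add: T_def)
      also have "\<dots> = (4 * real m) ^ M * (cmod (1 - z) ^ M * T)" by (simp add: power_mult_distrib)
      also have "\<dots> \<le> (4 * real m) ^ M * (8 * real m * K / real m ^ M)" using zT
        by (intro mult_left_mono) auto
      \<comment> \<open>The powers \<open>m ^ M\<close> cancel; the remaining single factor
        \<open>m\<close> is absorbed by the lower bound on \<open>F\<close>.\<close>
      also have "\<dots> = 4 ^ M * 16 * K / \<kappa> * (\<kappa> * (real m / 2))" using m \<kappa>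
        by (simp add: power_mult_distrib)
      also have "\<dots> \<le> 4 ^ M * 16 * K / \<kappa> * F" using F K(1) \<kappa> by (intro mult_left_mono) auto
      also have "\<dots> \<le> c * F" using c_ge F_pos by (intro mult_right_mono) auto
      finally have "(1 + real_of_int r) ^ M * (T / F) \<le> c" using F_pos
        by (simp add: pos_divide_le_eq)
      moreover have "(1 + real_of_int r) ^ M * corr \<le> (1 + real_of_int r) ^ M * (T / F)"
        using corr_le r by (intro mult_left_mono) auto
      ultimately show ?thesis by linarith
    qed
    then have "(1 + real_of_int r) ^ M * corr \<le> 2 * c" using c_ge by linarith
    moreover have "(1 + real_of_int r) ^ M > 0" using r by simp
    ultimately have "corr \<le> 2 * c / (1 + real_of_int r) ^ M"
      by (simp add: pos_le_divide_eq mult.commute)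
    then show ?thesis by (simp only: corr_def r_def b(1))
  qed
  then show ?thesis using c_ge by (intro exI[of _ c]) (auto simp: Let_def)
qed

end
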